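(* Let $P$ be any labelled poset (with positive integer edge labels) and $\delta P$ its doubled réseau. Then the modified descent Pieri operators on $\delta P$ are Eulerian, and for all $x\le y$ in $P$ we have $$K_{\delta[x,y]}=\widetilde{K}_{[x,y]}=\sum_\alpha c_{x,\alpha}^y\,\theta_\alpha ,$$ where the sum is only over peak compositions $\alpha$, and $c_{x,\alpha}^y$ is the number of saturated chains of $P$ in $[x,y]$ whose peak composition is $\alpha$.
   Context: $NC=\mathbb{Z}\langle h_1,h_2,\ldots\rangle$ is the free associative algebra with one generator $h_k$ in each degree $k\ge1$, a Hopf algebra with $\Delta h_k=\sum_{i=0}^k h_i\otimes h_{k-i}$, $h_0=1$. $\mathcal{Q}\mathit{sym}$ is the Hopf algebra of quasi-symmetric functions over $\mathbb{Z}$, the graded dual of $NC$, the monomial basis $M_\alpha$ being dual to $S^\alpha=h_{\alpha_1}\cdots h_{\alpha_\ell}$ ($\alpha$ a composition). A labelled poset is a graded poset $P$ whose covers are labelled with integers, here positive; each element has finitely many upper and lower covers. A subset $\{j_1<\cdots<j_s\}$ of $\{1,\dots,k-1\}$ corresponds to the composition $(j_1,j_2-j_1,\dots,k-j_s)$ of $k$. A labelled chain $x_0\xrightarrow{b_1}x_1\xrightarrow{b_2}\cdots\xrightarrow{b_k}x_k$ has a peak at $i$ ($1<i<k$) if $b_{i-1}\le b_i>b_{i+1}$; its peak composition $\Lambda(\omega)$ is the composition of $k$ associated to its set of peaks. The peak enumerator is $\widetilde K_{[x,y]}=\sum_\omega\theta_{\Lambda(\omega)}$, over all saturated chains $\omega$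 in $[x,y]$. For compositions of $m$, $\beta\preccurlyeq\alpha$ means $\beta$ refines $\alpha$; $\beta^*$ is obtained from $\beta$ by replacing every component $\beta_i>1$ with $i>1$ by $1,\beta_i-1$; $k(\beta)$ is the number of components of $\beta$. A peak composition is one with all components greater than $1$ except perhaps the last, and then $\theta_\alpha=\sum_{\beta\models m,\ \beta^*\preccurlyeq\alpha}2^{k(\beta)}M_\beta$ ($\theta_\emptyset=1$) is a peak function. $\Pi_{\mathbb{Q}}$ is the $\mathbb{Q}$-span of the peak functions. The doubled réseau $\delta P$ is the labelled directed multigraph with vertex set $P$ in which every cover $x\xrightarrow{b}y$ of $P$ is replaced by two edges $x\to y$ labelled $b$ and $-b$; $\delta[x,y]$ is the corresponding set of paths from $x$ to $y$ in $\delta P$. A path in $\delta P$ with labels $b_1,\dots,b_k$ has a (modified) descent at $i$ if $b_i>b_{i+1}$ or $b_i=b_{i+1}<0$. The modified descent Pieri operators are $x.\overline{h}_k=\sum_\omega\mathrm{end}(\omega)$, summed over all paths $\omega$ of length $k$ in $\delta P$ starting at $x$ with no descents, where $\mathrm{end}(\omega)$ is the final vertex. They make $\mathbb{Z}P$ (the free $\mathbb{Z}$-module on $P$) a right $NC$-module via $h_k\mapsto \overline{h}_k$, and $K_{\delta[x,y]}\in\mathcal{Q}\mathit{sym}$ is the functional sending $\Psi\in NC$ to the coefficient of $y$ in $x.\Psi$; i.e. $K_{\delta[x,y]}=\sum_\alpha\langle x.S^\alpha,y\rangle M_\alpha$, where $\langle x.S^\alpha,y\rangle$ is that coefficient for $\Psi=S^\alpha$.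 For a product of such intervals, $K$ is the analogous matrix coefficient of the $NC$-action on $(\mathbb{Z}P)^{\otimes k}$ given by the iterated coproduct of $NC$. The Pieri operators are called Eulerian if all these functions $K$ (the image of $K$) lie in $\Pi_{\mathbb{Q}}$. *)

theory Defs
  imports
    "HOL-Library.Poly_Mapping"
    "HOL-Library.Function_Algebras"
    "HOL-Library.Product_Plus"
    "Graph_Theory.Arc_Walk"
begin

section \<open>Compositions\<close>

typedef composition = "{bs :: nat list. 0 \<notin> set bs}"
  morphisms parts Composition
  by (rule exI[of _ "[]"]) simp

lemma parts_Composition: "0 \<notin> set bs \<Longrightarrow> parts (Composition bs) = bs"
  by (simp add: Composition_inverse)

lemma parts_pos: "0 \<notin> set (parts \<alpha>)"
  using parts[of \<alpha>] by simp

text \<open>Addition is concatenation, so compositions are the free monoid on the positive integers.\<close>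

instantiation composition :: monoid_add
begin

definition zero_composition :: composition
  where "0 = Composition []"

definition plus_composition :: "composition \<Rightarrow> composition \<Rightarrow> composition"
  where "\<alpha> + \<beta> = Composition (parts \<alpha> @ parts \<beta>)"

lemma parts_zero: "parts 0 = []"
  by (simp add: zero_composition_def parts_Composition)

lemma parts_plus: "parts (\<alpha> + \<beta>) = parts \<alpha> @ parts \<beta>"
  by (simp add: plus_composition_def parts_Composition parts_pos)

instance
  by standard (simp_all add: parts_inject[symmetric] parts_zero parts_plus)

end

definition comp_size :: "composition \<Rightarrow> nat"
  where "comp_size \<alpha> = sum_list (parts \<alpha>)"

text \<open>\<open>refines \<beta> \<alpha>\<close>: summing consecutive blocks of \<open>\<beta>\<close> gives \<open>\<alpha>\<close>. As the parts of \<open>\<alpha>\<close> are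
  positive, no block is empty.\<close>

definition refines :: "composition \<Rightarrow> composition \<Rightarrow> bool"
  where "refines \<beta> \<alpha> \<longleftrightarrow> (\<exists>bss. parts \<beta> = concat bss \<and> parts \<alpha> = map sum_list bss)"

fun star_list :: "nat list \<Rightarrow> nat list" where
  "star_list [] = []"
| "star_list (b # bs) = b # concat (map (\<lambda>c. if c > 1 then [1, c - 1] else [c]) bs)"

definition comp_star :: "composition \<Rightarrow> composition"
  where "comp_star \<beta> = Composition (star_list (parts \<beta>))"

lemma parts_comp_star: "parts (comp_star \<beta>) = star_list (parts \<beta>)"
proof -
  have "0 \<notin> set (star_list bs)" if "0 \<notin> set bs" for bs
    using that by (cases bs) (auto split: if_splits)
  then show ?thesis
    by (simp add: comp_star_def parts_Composition parts_pos)
qed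

definition peak_composition :: "composition \<Rightarrow> bool"
  where "peak_composition \<alpha> \<longleftrightarrow> (\<forall>a \<in> set (butlast (parts \<alpha>)). a > 1)"

text \<open>The composition of \<open>k\<close> associated with a subset \<open>J\<close> of \<open>{1..<k}\<close>.\<close>

definition comp_of_set :: "nat \<Rightarrow> nat set \<Rightarrow> composition"
  where "comp_of_set k J = (if k = 0 then 0 else
    (let js = sorted_list_of_set J in Composition (map2 (\<lambda>i j. j - i) (0 # js) (js @ [k]))))"


section \<open>Free abelian groups\<close>

text \<open>The free abelian group on \<^typ>\<open>'a\<close> is \<^typ>\<open>'a \<Rightarrow>\<^sub>0 int\<close>, with basis \<^const>\<open>frag_of\<close> and linear
  extension \<^const>\<open>frag_extend\<close>. Bilinear extension with \<open>f = Pair\<close>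
  or \<open>f = (#)\<close> gives tensor products of free abelian groups.\<close>

definition frag_bilin :: "('a \<Rightarrow> 'b \<Rightarrow> 'c) \<Rightarrow> ('a \<Rightarrow>\<^sub>0 int) \<Rightarrow> ('b \<Rightarrow>\<^sub>0 int) \<Rightarrow> 'c \<Rightarrow>\<^sub>0 int"
  where "frag_bilin f u v = frag_extend (\<lambda>a. frag_extend (\<lambda>b. frag_of (f a b)) v) u"


section \<open>The Hopf algebra NC\<close>

text \<open>The free associative algebra is the monoid algebra of the free monoid; its product is the
  convolution product of \<^type>\<open>poly_mapping\<close>, and \<open>S\<^sup>\<alpha>\<close> is \<^term>\<open>frag_of \<alpha>\<close>
  (lemma \<open>frag_of_eq_prod_gen\<close>). Similarly
  \<open>NC \<otimes> NC\<close> is the monoid algebra of the product monoid.\<close>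

type_synonym nc = "composition \<Rightarrow>\<^sub>0 int"

definition nc_gen :: "nat \<Rightarrow> nc"
  where "nc_gen k = (if k = 0 then 1 else frag_of (Composition [k]))"

definition nc_coproduct :: "nc \<Rightarrow> (composition \<times> composition) \<Rightarrow>\<^sub>0 int"
  where "nc_coproduct = frag_extend
    (\<lambda>\<alpha>. \<Prod>k\<leftarrow>parts \<alpha>. \<Sum>i\<le>k. frag_bilin Pair (nc_gen i) (nc_gen (k - i)))"

text \<open>The iterated coproduct \<open>NC \<rightarrow> NC\<^sup>\<otimes>\<^sup>n\<close>; pure tensors of basis elements are lists of length \<open>n\<close>.
  For \<open>n = 0\<close> it is the counit, and for \<open>n = 1\<close> the identity.\<close>

primrec nc_iter_coproduct :: "nat \<Rightarrow> nc \<Rightarrow> composition list \<Rightarrow>\<^sub>0 int" where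
  "nc_iter_coproduct 0 \<Psi> = frag_cmul (Poly_Mapping.lookup \<Psi> 0) (frag_of [])"
| "nc_iter_coproduct (Suc n) \<Psi> = frag_extend
    (\<lambda>(\<beta>, \<gamma>). frag_bilin (#) (frag_of \<beta>) (nc_iter_coproduct n (frag_of \<gamma>))) (nc_coproduct \<Psi>)"


section \<open>Quasi-symmetric functions and peak functions\<close>

text \<open>Quasi-symmetric functions are represented as functionals on NC, via the graded duality;
  the coefficient of \<open>M\<^sub>\<beta>\<close> is the value at \<open>S\<^sup>\<beta>\<close>. Sums of functionals are pointwise; the
  pointwise product is not that of the algebra of quasi-symmetric functions and is not used.\<close>

definition qsym_M :: "composition \<Rightarrow> nc \<Rightarrow> int"
  where "qsym_M \<beta> = (\<lambda>\<Psi>. Poly_Mapping.lookup \<Psi> \<beta>)"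

definition qsym_theta :: "composition \<Rightarrow> nc \<Rightarrow> int"
  where "qsym_theta \<alpha> =
    (\<Sum>\<beta> | comp_size \<beta> = comp_size \<alpha> \<and> refines (comp_star \<beta>) \<alpha>.
      (\<lambda>\<Psi>. 2 ^ length (parts \<beta>) * qsym_M \<beta> \<Psi>))"

definition qsym_rat :: "(nc \<Rightarrow> int) \<Rightarrow> nc \<Rightarrow> rat"
  where "qsym_rat F = (\<lambda>\<Psi>. of_int (F \<Psi>))"

definition rat_scale :: "rat \<Rightarrow> (nc \<Rightarrow> rat) \<Rightarrow> nc \<Rightarrow> rat"
  where "rat_scale c F = (\<lambda>\<Psi>. c * F \<Psi>)"

lemma vector_space_rat_scale: "vector_space rat_scale"
  by standard (auto simp: rat_scale_def fun_eq_iff algebra_simps)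

definition Pi_rat :: "(nc \<Rightarrow> rat) set"
  where "Pi_rat = module.span rat_scale {qsym_rat (qsym_theta \<alpha>) | \<alpha>. peak_composition \<alpha>}"


section \<open>Pieri operators\<close>

text \<open>A family of Pieri operators is given by the elements \<open>H k x = x.h\<^sub>k\<close> of the free abelian group on
  the poset, for \<open>k \<ge> 1\<close>. The product \<open>S\<^sup>\<alpha>\<close> acts on the right, so \<open>h\<close> of the first part is applied
  first.\<close>

definition pieri_act :: "(nat \<Rightarrow> 'a \<Rightarrow> 'a \<Rightarrow>\<^sub>0 int) \<Rightarrow> ('a \<Rightarrow>\<^sub>0 int) \<Rightarrow> nc \<Rightarrow> 'a \<Rightarrow>\<^sub>0 int"
  where "pieri_act H v = frag_extend (\<lambda>\<alpha>. foldl (\<lambda>w k. frag_extend (H k) w) v (parts \<alpha>))"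

definition pieri_K :: "(nat \<Rightarrow> 'a \<Rightarrow> 'a \<Rightarrow>\<^sub>0 int) \<Rightarrow> 'a \<Rightarrow> 'a \<Rightarrow> nc \<Rightarrow> int"
  where "pieri_K H x y = (\<lambda>\<Psi>. Poly_Mapping.lookup (pieri_act H (frag_of x) \<Psi>) y)"

text \<open>The action on tensor powers: \<open>x\<^sub>1 \<otimes> \<dots> \<otimes> x\<^sub>n\<close> is the list \<open>[x\<^sub>1, \<dots>, x\<^sub>n]\<close>, and \<open>NC\<close> acts through
  its \<open>n\<close>-fold iterated coproduct.\<close>

definition pieri_tensor_act ::
    "(nat \<Rightarrow> 'a \<Rightarrow> 'a \<Rightarrow>\<^sub>0 int) \<Rightarrow> ('a list \<Rightarrow>\<^sub>0 int) \<Rightarrow> nc \<Rightarrow> 'a list \<Rightarrow>\<^sub>0 int"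
  where "pieri_tensor_act H v \<Psi> = frag_extend (\<lambda>xs. frag_extend
      (\<lambda>\<beta>s. foldr (frag_bilin (#))
        (map2 (\<lambda>x \<beta>. pieri_act H (frag_of x) (frag_of \<beta>)) xs \<beta>s) (frag_of []))
      (nc_iter_coproduct (length xs) \<Psi>)) v"

text \<open>\<open>pieri_K_prod H xs ys\<close> is \<open>K\<close> of the product of the intervals \<open>[xs ! i, ys ! i]\<close>.\<close>

definition pieri_K_prod :: "(nat \<Rightarrow> 'a \<Rightarrow> 'a \<Rightarrow>\<^sub>0 int) \<Rightarrow> 'a list \<Rightarrow> 'a list \<Rightarrow> nc \<Rightarrow> int"
  where "pieri_K_prod H xs ys = (\<lambda>\<Psi>. Poly_Mapping.lookup (pieri_tensor_act H (frag_of xs) \<Psi>) ys)"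

definition eulerian :: "(nat \<Rightarrow> 'a::order \<Rightarrow> 'a \<Rightarrow>\<^sub>0 int) \<Rightarrow> bool"
  where "eulerian H \<longleftrightarrow>
    (\<forall>x y. x \<le> y \<longrightarrow> qsym_rat (pieri_K H x y) \<in> Pi_rat) \<and>
    (\<forall>xs ys. list_all2 (\<le>) xs ys \<longrightarrow> qsym_rat (pieri_K_prod H xs ys) \<in> Pi_rat)"


section \<open>Labelled posets\<close>

definition covered_by :: "'a::order \<Rightarrow> 'a \<Rightarrow> bool"  (infix "\<lessdot>" 50)
  where "x \<lessdot> y \<longleftrightarrow> x < y \<and> {x<..<y} = {}"

text \<open>Only the labels \<open>lab x y\<close> with \<open>x \<lessdot> y\<close> are meaningful.\<close>

locale labelled_poset =
  fixes lab :: "'a::order \<Rightarrow> 'a \<Rightarrow> int"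
  assumes graded: "\<exists>rk :: 'a \<Rightarrow> int. (\<forall>x y. x < y \<longrightarrow> rk x < rk y) \<and> (\<forall>x y. x \<lessdot> y \<longrightarrow> rk y = rk x + 1)"
    and finite_upper_covers: "finite {y. x \<lessdot> y}"
    and finite_lower_covers: "finite {x. x \<lessdot> y}"
    and lab_pos: "x \<lessdot> y \<Longrightarrow> 0 < lab x y"

definition sat_chains :: "'a::order \<Rightarrow> 'a \<Rightarrow> 'a list set"
  where "sat_chains x y =
    {xs. xs \<noteq> [] \<and> hd xs = x \<and> last xs = y \<and> successively (\<lessdot>) xs}"

definition chain_labels :: "('a \<Rightarrow> 'a \<Rightarrow> int) \<Rightarrow> 'a list \<Rightarrow> int list"
  where "chain_labels lab xs = map2 lab (butlast xs) (tl xs)"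

text \<open>Positions in a label sequence \<open>b\<^sub>1, \<dots>, b\<^sub>k\<close> are counted from 1, whereas \<open>(!)\<close> counts from 0.\<close>

definition peaks :: "int list \<Rightarrow> nat set"
  where "peaks bs = {i. 1 < i \<and> i < length bs \<and>
    bs ! (i - 2) \<le> bs ! (i - 1) \<and> bs ! (i - 1) > bs ! i}"

definition chain_peak_comp :: "('a \<Rightarrow> 'a \<Rightarrow> int) \<Rightarrow> 'a list \<Rightarrow> composition"
  where "chain_peak_comp lab \<omega> =
    (let bs = chain_labels lab \<omega> in comp_of_set (length bs) (peaks bs))"

definition peak_enumerator :: "('a::order \<Rightarrow> 'a \<Rightarrow> int) \<Rightarrow> 'a \<Rightarrow> 'a \<Rightarrow> nc \<Rightarrow> int"
  where "peak_enumerator lab x y = (\<Sum>\<omega>\<in>sat_chains x y. qsym_theta (chain_peak_comp lab \<omega>))"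

definition peak_chain_count :: "('a::order \<Rightarrow> 'a \<Rightarrow> int) \<Rightarrow> 'a \<Rightarrow> composition \<Rightarrow> 'a \<Rightarrow> nat"
  where "peak_chain_count lab x \<alpha> y = card {\<omega> \<in> sat_chains x y. chain_peak_comp lab \<omega> = \<alpha>}"


section \<open>The doubled reseau and its modified descent Pieri operators\<close>

text \<open>An arc \<open>(x, b, y)\<close> runs from \<open>x\<close> to \<open>y\<close> and has label \<open>b\<close>. As labels of covers are nonzero,
  every cover gives exactly two arcs.\<close>

definition doubled_reseau :: "('a::order \<Rightarrow> 'a \<Rightarrow> int) \<Rightarrow> ('a, 'a \<times> int \<times> 'a) pre_digraph"
  where "doubled_reseau lab =
    \<lparr>verts = UNIV,
     arcs = {(x, b, y) | x b y. x \<lessdot> y \<and> (b = lab x y \<or> b = - lab x y)},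
     tail = (\<lambda>(x, b, y). x),
     head = (\<lambda>(x, b, y). y)\<rparr>"

definition path_labels :: "('a \<times> int \<times> 'a) list \<Rightarrow> int list"
  where "path_labels = map (\<lambda>(x, b, y). b)"

definition mod_descents :: "int list \<Rightarrow> nat set"
  where "mod_descents bs = {i. 1 \<le> i \<and> i < length bs \<and>
    (bs ! (i - 1) > bs ! i \<or> bs ! (i - 1) = bs ! i \<and> bs ! i < 0)}"

definition mod_descent_pieri :: "('a::order \<Rightarrow> 'a \<Rightarrow> int) \<Rightarrow> nat \<Rightarrow> 'a \<Rightarrow> 'a \<Rightarrow>\<^sub>0 int"
  where "mod_descent_pieri lab k x =
    (\<Sum>\<omega> | (\<exists>z. pre_digraph.awalk (doubled_reseau lab) x \<omega> z) \<and> length \<omega> = k \<and>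
            mod_descents (path_labels \<omega>) = {}.
      frag_of (pre_digraph.awlast (doubled_reseau lab) x \<omega>))"


section \<open>Basic properties of the encoding\<close>

lemma prod_gen_frag: "0 \<notin> set bs \<Longrightarrow> prod_list (map nc_gen bs) = frag_of (Composition bs)"
proof (induction bs)
  case Nil
  show ?case by (simp flip: zero_composition_def)
next
  case (Cons b bs)
  then show ?case
    by (simp add: nc_gen_def mult_single plus_composition_def parts_Composition)
qed

lemma frag_of_eq_prod_gen: "frag_of \<alpha> = (\<Prod>k\<leftarrow>parts \<alpha>. nc_gen k)"
  by (simp add: prod_gen_frag parts_pos parts_inverse)

lemma frag_extend_sum': "frag_extend f (\<Sum>i\<in>I. g i) = (\<Sum>i\<in>I. frag_extend f (g i))"
  by (induction I rule: infinite_finite_induct) (simp_all add: frag_extend_add)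

lemma frag_add_induct [case_names of_basis uminus plus zero]:
  assumes "\<And>a. P (frag_of a)" "\<And>u. P u \<Longrightarrow> P (- u)" "\<And>u v. P u \<Longrightarrow> P v \<Longrightarrow> P (u + v)" "P 0"
  shows "P (u :: 'a \<Rightarrow>\<^sub>0 int)"
  using subset_UNIV
proof (induction u rule: frag_induction)
  case (diff a b)
  have "P (a + - b)" using assms diff by blast
  then show ?case by simp
qed (use assms in auto)

lemma nc_coproduct_mult: "nc_coproduct (\<Psi> * \<Phi>) = nc_coproduct \<Psi> * nc_coproduct \<Phi>"
proof (induction \<Psi> rule: frag_add_induct)
  case (of_basis \<alpha>)
  show ?case
    by (induction \<Phi> rule: frag_add_induct)
      (simp_all add: nc_coproduct_def mult_single parts_plus frag_extend_add frag_extend_minus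
        distrib_left)
qed (simp_all add: nc_coproduct_def frag_extend_add frag_extend_minus distrib_right)

lemma nc_coproduct_gen:
  "nc_coproduct (nc_gen k) = (\<Sum>i\<le>k. frag_bilin Pair (nc_gen i) (nc_gen (k - i)))"
proof (cases "k = 0")
  case True
  then show ?thesis
    by (simp add: nc_coproduct_def nc_gen_def frag_bilin_def parts_zero zero_prod_def mult_single
        flip: single_one)
qed (simp add: nc_coproduct_def nc_gen_def parts_Composition)

lemma pieri_act_one: "pieri_act H v 1 = v"
  by (simp add: pieri_act_def parts_zero flip: single_one)

lemma pieri_act_gen: "k > 0 \<Longrightarrow> pieri_act H (frag_of x) (nc_gen k) = H k x"
  by (simp add: pieri_act_def nc_gen_def parts_Composition)

lemma pieri_act_add: "pieri_act H (u + v) \<Psi> = pieri_act H u \<Psi> + pieri_act H v \<Psi>"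
proof (induction \<Psi> rule: frag_add_induct)
  case (of_basis \<alpha>)
  have "foldl (\<lambda>w k. frag_extend (H k) w) (u + v) bs =
    foldl (\<lambda>w k. frag_extend (H k) w) u bs + foldl (\<lambda>w k. frag_extend (H k) w) v bs" for bs
    by (induction bs arbitrary: u v) (simp_all add: frag_extend_add)
  then show ?case by (simp add: pieri_act_def)
qed (simp_all add: pieri_act_def frag_extend_add frag_extend_minus)

lemma pieri_act_add_right: "pieri_act H v (\<Psi> + \<Phi>) = pieri_act H v \<Psi> + pieri_act H v \<Phi>"
  by (simp add: pieri_act_def frag_extend_add)

lemma pieri_act_zero: "pieri_act H 0 \<Psi> = 0"
  using pieri_act_add[of H 0 0 \<Psi>] by simp

lemma pieri_act_minus: "pieri_act H (- v) \<Psi> = - pieri_act H v \<Psi>"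
  using pieri_act_add[of H v "- v" \<Psi>]
  by (simp add: pieri_act_zero eq_neg_iff_add_eq_0 add.commute)

lemma pieri_act_mult: "pieri_act H v (\<Psi> * \<Phi>) = pieri_act H (pieri_act H v \<Psi>) \<Phi>"
proof (induction \<Psi> rule: frag_add_induct)
  case (of_basis \<alpha>)
  show ?case
    by (induction \<Phi> rule: frag_add_induct)
      (simp_all add: pieri_act_def mult_single parts_plus frag_extend_add frag_extend_minus
        distrib_left)
next
  case zero
  have "pieri_act H v 0 = 0" by (simp add: pieri_act_def)
  then show ?case by (simp add: pieri_act_zero)
next
  case (uminus \<Psi>)
  have "pieri_act H v (- \<Psi>) = - pieri_act H v \<Psi>" for \<Psi>
    by (simp add: pieri_act_def frag_extend_minus)
  with uminus show ?case by (simp add: pieri_act_minus)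
next
  case (plus \<Psi> \<Psi>')
  then show ?case by (simp add: distrib_right pieri_act_add pieri_act_add_right)
qed

lemma plus_composition_eq_0_iff: "\<alpha> + \<beta> = 0 \<longleftrightarrow> \<alpha> = 0 \<and> \<beta> = (0 :: composition)"
  by (simp add: parts_inject[symmetric] parts_zero parts_plus)

lemma nc_counit:
  "frag_extend (\<lambda>(\<beta>, \<gamma>). if \<gamma> = 0 then frag_of \<beta> else 0) (nc_coproduct \<Psi>) = \<Psi>"
proof -
  define e :: "composition \<times> composition \<Rightarrow> nc"
    where "e = (\<lambda>(\<beta>, \<gamma>). if \<gamma> = 0 then frag_of \<beta> else 0)"
  have e: "e (p + q) = e p * e q" for p q
    by (auto simp: e_def plus_composition_eq_0_iff mult_single split: prod.splits)
  have E_mult: "frag_extend e (u * v) = frag_extend e u * frag_extend e v" for u v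
  proof (induction u rule: frag_add_induct)
    case (of_basis p)
    show ?case
      by (induction v rule: frag_add_induct)
        (simp_all add: mult_single e frag_extend_add frag_extend_minus distrib_left)
  qed (simp_all add: frag_extend_add frag_extend_minus distrib_right)
  have E_tensor: "frag_extend e (frag_bilin Pair u (nc_gen j)) = (if j = 0 then u else 0)" for u j
  proof (induction u rule: frag_add_induct)
    case (of_basis \<alpha>)
    have "Composition [j] \<noteq> 0" if "j \<noteq> 0"
      using that by (simp add: parts_inject[symmetric] parts_zero parts_Composition)
    then show ?case
      by (simp add: frag_bilin_def nc_gen_def e_def flip: single_one)
  qed (simp_all add: frag_bilin_def frag_extend_add frag_extend_minus)
  have E_gen: "frag_extend e (\<Sum>i\<le>k. frag_bilin Pair (nc_gen i) (nc_gen (k - i))) = nc_gen k" for k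
  proof -
    have "(\<Sum>i\<le>k. if k - i = 0 then nc_gen i else 0) = (\<Sum>i\<le>k. if i = k then nc_gen i else 0)"
      by (intro sum.cong) auto
    then show ?thesis by (simp add: frag_extend_sum' E_tensor)
  qed
  have E_prod: "frag_extend e (\<Prod>k\<leftarrow>bs. \<Sum>i\<le>k. frag_bilin Pair (nc_gen i) (nc_gen (k - i))) =
      (\<Prod>k\<leftarrow>bs. nc_gen k)" for bs
    by (induction bs) (simp_all add: E_mult E_gen, simp add: e_def zero_prod_def flip: single_one)
  have "frag_extend e (nc_coproduct \<Psi>) = \<Psi>"
    by (induction \<Psi> rule: frag_add_induct)
      (simp_all add: nc_coproduct_def frag_extend_add frag_extend_minus E_prod
        flip: frag_of_eq_prod_gen)
  then show ?thesis by (simp add: e_def)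
qed

lemma nc_iter_coproduct_1: "nc_iter_coproduct (Suc 0) \<Psi> = frag_extend (\<lambda>\<beta>. frag_of [\<beta>]) \<Psi>"
proof -
  let ?e = "\<lambda>(\<beta>, \<gamma>). if \<gamma> = 0 then frag_of \<beta> else 0"
  have "nc_iter_coproduct (Suc 0) \<Psi> =
      frag_extend (\<lambda>\<beta>. frag_of [\<beta>]) (frag_extend ?e (nc_coproduct \<Psi>))"
  proof -
    have "frag_extend (\<lambda>(\<beta>, \<gamma>). frag_bilin (#) (frag_of \<beta>) (nc_iter_coproduct 0 (frag_of \<gamma>))) w =
        frag_extend (\<lambda>\<beta>. frag_of [\<beta>]) (frag_extend ?e w)" for w
      by (induction w rule: frag_add_induct)
        (auto simp: frag_bilin_def frag_extend_add frag_extend_minus)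
    then show ?thesis by simp
  qed
  then show ?thesis by (simp only: nc_counit)
qed

lemma pieri_K_prod_singleton: "pieri_K_prod H [x] [y] = pieri_K H x y"
proof -
  have tl: "Poly_Mapping.lookup (frag_bilin (#) v (frag_of [])) [y] = Poly_Mapping.lookup v y" for v
    by (induction v rule: frag_add_induct)
      (simp_all add: frag_bilin_def frag_extend_add frag_extend_minus lookup_add)
  have "Poly_Mapping.lookup (pieri_tensor_act H (frag_of [x]) \<Psi>) [y] =
      Poly_Mapping.lookup (pieri_act H (frag_of x) \<Psi>) y" for \<Psi>
  proof (induction \<Psi> rule: frag_add_induct)
    case (of_basis \<alpha>)
    show ?case
      by (simp add: pieri_tensor_act_def nc_iter_coproduct_1 tl del: nc_iter_coproduct.simps)
  qed (simp_all add: pieri_tensor_act_def nc_iter_coproduct_1 pieri_act_def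
      frag_extend_add frag_extend_minus lookup_add del: nc_iter_coproduct.simps)
  then show ?thesis by (simp add: pieri_K_prod_def pieri_K_def)
qed

end

theory Submission
  imports Defs "HOL-Library.Multiset"
begin

text \<open>The coefficient of \<open>M\<^sub>\<alpha>\<close> in the function of \<open>\<delta>[x, y]\<close> counts pairs of a saturated chain and a choice
  of signs for its labels without descents inside the blocks of \<open>\<alpha>\<close>. A descent-free signing of a block
  makes an initial strictly decreasing run negative, and the rest, which has to increase weakly, positive.
  Hence a nonempty block has two such signings if it has no interior peak (the smallest letter at the turning
  point may take either sign) and none otherwise. The interior peaks are those at positions outside
  \<open>D \<union> (D + 1)\<close>, where \<open>D\<close> is the set of partial sums of \<open>\<alpha>\<close>; this set belongs to \<open>\<alpha>\<^sup>*\<close>.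

  For products of intervals, two descent-free words over disjoint alphabets have exactly one descent-free
  shuffle, namely the sorted one. So the product of the peak functions of two words with disjoint alphabets
  is the sum of the peak functions of their shuffles.\<close>

section \<open>Partial sums and refinement\<close>

text \<open>Both endpoints, 0 and the total, are kept. Concatenation then becomes a union with a
  shifted copy, and refinement becomes plain inclusion.\<close>

fun psums :: "nat list \<Rightarrow> nat set" where
  "psums [] = {0}"
| "psums (b # bs) = insert 0 ((+) b ` psums bs)"

lemma zero_in_psums: "0 \<in> psums bs"
  by (cases bs) auto

lemma psums_le_sum_list: "d \<in> psums bs \<Longrightarrow> d \<le> sum_list bs"
  by (induction bs arbitrary: d) auto

lemma sum_list_in_psums: "sum_list bs \<in> psums bs"
  by (induction bs) auto

lemma psums_append: "psums (bs @ cs) = psums bs \<union> (+) (sum_list bs) ` psums cs"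
  by (induction bs) (auto simp: zero_in_psums image_iff add.assoc)

lemma psums_split:
  assumes "d \<in> psums bs"
  obtains bs1 bs2 where "bs = bs1 @ bs2" "sum_list bs1 = d"
  using assms
proof (induction bs arbitrary: d thesis)
  case Nil
  then show ?case by simp
next
  case (Cons b bs)
  show ?case
  proof (cases "d = 0")
    case True
    then show ?thesis using Cons.prems(1)[of "[]"] by simp
  next
    case False
    then obtain d' where d': "d' \<in> psums bs" "d = b + d'" using Cons.prems(2) by auto
    from Cons.IH[OF _ d'(1)] obtain bs1 bs2 where "bs = bs1 @ bs2" "sum_list bs1 = d'" by blast
    then show ?thesis using Cons.prems(1)[of "b # bs1" bs2] d'(2) by simp
  qed
qed

lemma psums_map_sum_list: "psums (map sum_list bss) \<subseteq> psums (concat bss)"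
  by (induction bss) (auto simp: psums_append zero_in_psums)

text \<open>Induction on \<open>as\<close>: its first part is a partial sum of \<open>bs\<close>, so
  \<open>bs\<close> can be cut there, and the later partial sums of \<open>as\<close> pass to the
  second piece. Positivity of the parts of \<open>bs\<close> enters in the base case, where it rules
  out leftover zeros.\<close>

lemma blocks_if_psums_subset:
  assumes "0 \<notin> set bs" "sum_list as = sum_list bs" "psums as \<subseteq> psums bs"
  shows "\<exists>bss. bs = concat bss \<and> as = map sum_list bss"
  using assms
proof (induction as arbitrary: bs)
  case Nil
  then have "bs = []" by (cases bs) auto
  then show ?case by (intro exI[of _ "[]"]) simp
next
  case (Cons a as)
  have "a \<in> psums bs" using Cons.prems(3) zero_in_psums[of as] by auto
  then obtain bs1 bs2 where bs: "bs = bs1 @ bs2" "sum_list bs1 = a" by (rule psums_split)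
  have "psums as \<subseteq> psums bs2"
  proof
    fix d assume d: "d \<in> psums as"
    then have "a + d \<in> psums bs1 \<union> (+) a ` psums bs2"
      using Cons.prems(3) bs by (auto simp: psums_append)
    \<comment> \<open>For d > 0 the number a + d exceeds the total of \<open>bs1\<close>, so it can
      only come from \<open>bs2\<close>.\<close>
    then show "d \<in> psums bs2"
      using psums_le_sum_list[of "a + d" bs1] bs zero_in_psums[of bs2] by (cases "d = 0") auto
  qed
  then obtain bss where "bs2 = concat bss" "as = map sum_list bss"
    using Cons.IH[of bs2] Cons.prems bs by auto
  then show ?case using bs by (intro exI[of _ "bs1 # bss"]) simp
qed

lemma refines_iff_psums:
  assumes "comp_size \<beta> = comp_size \<alpha>"
  shows "refines \<beta> \<alpha> \<longleftrightarrow> psums (parts \<alpha>) \<subseteq> psums (parts \<beta>)"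
proof
  assume "refines \<beta> \<alpha>"
  then obtain bss where "parts \<beta> = concat bss" "parts \<alpha> = map sum_list bss"
    by (auto simp: refines_def)
  then show "psums (parts \<alpha>) \<subseteq> psums (parts \<beta>)" using psums_map_sum_list[of bss] by simp
next
  assume "psums (parts \<alpha>) \<subseteq> psums (parts \<beta>)"
  then show "refines \<beta> \<alpha>"
    using assms blocks_if_psums_subset[OF parts_pos, of "parts \<alpha>" \<beta>]
    by (auto simp: refines_def comp_size_def)
qed

text \<open>A part starting after the partial sum d yields d + 1 as well: a part greater than 1 by
  being split, a part 1 by ending there.\<close>

lemma psums_concat_one_split:
  assumes "0 \<notin> set bs"
  shows "psums (concat (map (\<lambda>c. if c > 1 then [1, c - 1] else [c]) bs)) =
    psums bs \<union> Suc ` {d \<in> psums bs. d < sum_list bs}"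
  using assms
proof (induction bs)
  case (Cons c bs)
  let ?st = "concat (map (\<lambda>c. if c > 1 then [1, c - 1] else [c]) bs)"
  have "psums (concat (map (\<lambda>c. if c > 1 then [1, c - 1] else [c]) (c # bs))) =
      insert 0 (insert 1 ((+) c ` psums ?st))"
    using Cons.prems zero_in_psums[of ?st] by (cases "c = 1") (auto simp: image_iff)
  also have "\<dots> = psums (c # bs) \<union> Suc ` {d \<in> psums (c # bs). d < sum_list (c # bs)}"
    using Cons by (auto simp: image_iff)
  finally show ?case .
qed simp

lemma sum_list_star_list: "0 \<notin> set bs \<Longrightarrow> sum_list (star_list bs) = sum_list bs"
proof (cases bs)
  case (Cons b cs)
  have "sum_list (concat (map (\<lambda>c. if c > 1 then [1, c - 1] else [c]) cs)) = sum_list cs"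
    by (induction cs) auto
  then show ?thesis using Cons by simp
qed simp

text \<open>The first part is never split, which is why d = 0 gains no successor on the
  right.\<close>

lemma psums_star_list:
  assumes "0 \<notin> set bs"
  shows "psums (star_list bs) = psums bs \<union> Suc ` {d \<in> psums bs. 0 < d \<and> d < sum_list bs}"
proof (cases bs)
  case (Cons b cs)
  then show ?thesis using assms psums_concat_one_split[of cs]
    by (auto simp: image_iff)
qed simp

text \<open>The differences telescope. The starting point \<open>p\<close> is arbitrary so that the
  induction can move it to the next element; the application has p = 0.\<close>

lemma psums_diffs:
  assumes "sorted_wrt (<) (p # js @ [n])"
  defines "ds \<equiv> map2 (\<lambda>i j. j - i) (p # js) (js @ [n])"
  shows "0 \<notin> set ds \<and> sum_list ds = n - p \<and> (+) p ` psums ds = {p, n} \<union> set js"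
  using assms(1) unfolding ds_def
proof (induction js arbitrary: p)
  case (Cons j js)
  let ?ds = "map2 (\<lambda>i j. j - i) (j # js) (js @ [n])"
  have IH: "0 \<notin> set ?ds" "sum_list ?ds = n - j" "(+) j ` psums ?ds = {j, n} \<union> set js"
    using Cons.IH[of j] Cons.prems by auto
  have "(+) p ` (insert 0 ((+) (j - p) ` psums ?ds)) = insert p ((+) j ` psums ?ds)"
    using Cons.prems by (auto simp: image_image)
  then show ?case using IH Cons.prems by auto
qed auto

lemma comp_of_set_parts:
  assumes "J \<subseteq> {1..<n}"
  shows "comp_size (comp_of_set n J) = n" "psums (parts (comp_of_set n J)) = {0, n} \<union> J"
proof -
  have fin: "finite J" using assms finite_subset by blast
  let ?ds = "map2 (\<lambda>i j. j - i) (0 # sorted_list_of_set J) (sorted_list_of_set J @ [n])"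
  have "0 \<notin> set ?ds \<and> sum_list ?ds = n - 0 \<and> (+) 0 ` psums ?ds = {0, n} \<union> set (sorted_list_of_set J)"
    if "n > 0"
    using assms that fin by (intro psums_diffs) (auto simp: sorted_wrt_append)
  then show "comp_size (comp_of_set n J) = n" "psums (parts (comp_of_set n J)) = {0, n} \<union> J"
    using assms fin
    by (auto simp: comp_of_set_def comp_size_def Let_def parts_Composition parts_zero)
qed

text \<open>A part 1 before the last one would produce consecutive partial sums, the larger of which
  is still below the total.\<close>

lemma butlast_gt_1_if_psums:
  assumes "0 \<notin> set bs" "\<And>d. d \<in> psums bs \<Longrightarrow> Suc d \<in> psums bs \<Longrightarrow> Suc d < sum_list bs \<Longrightarrow> False"
  shows "\<forall>b\<in>set (butlast bs). b > 1"
  using assms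
proof (induction bs)
  case (Cons b bs)
  have "\<forall>b\<in>set (butlast bs). b > 1"
  proof (intro Cons.IH)
    show False if "d \<in> psums bs" "Suc d \<in> psums bs" "Suc d < sum_list bs" for d
      using Cons.prems(2)[of "b + d"] that by (auto simp: image_iff)
  qed (use Cons.prems in simp)
  moreover have "b > 1" if "bs \<noteq> []"
  proof (rule ccontr)
    assume "\<not> b > 1"
    then have "b = 1" using Cons.prems(1) by (cases b) auto
    moreover have "sum_list bs > 0" using that Cons.prems(1) by (cases bs) auto
    ultimately show False using Cons.prems(2)[of 0] zero_in_psums[of bs] by auto
  qed
  ultimately show ?case by auto
qed simp

lemma peaks_subset: "peaks bs \<subseteq> {1..<length bs}"
  by (auto simp: peaks_def)

section \<open>Peak compositions of words\<close>

text \<open>Attached to words rather than chains, because shuffles of label words need not be label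
  words of chains.\<close>

definition word_peak_comp :: "int list \<Rightarrow> composition"
  where "word_peak_comp u = comp_of_set (length u) (peaks u)"

lemma comp_size_word_peak_comp: "comp_size (word_peak_comp u) = length u"
  using comp_of_set_parts(1)[OF peaks_subset] by (simp add: word_peak_comp_def)

text \<open>A peak is followed by a strict descent, so the next position is not a peak; and position
  1 is never a peak.\<close>

lemma peak_composition_word_peak_comp: "peak_composition (word_peak_comp u)"
proof -
  let ?bs = "parts (word_peak_comp u)"
  have ps: "psums ?bs = {0, length u} \<union> peaks u" and sm: "sum_list ?bs = length u"
    using comp_of_set_parts[OF peaks_subset, of u] by (auto simp: word_peak_comp_def comp_size_def)
  have "False" if "d \<in> psums ?bs" "Suc d \<in> psums ?bs" "Suc d < sum_list ?bs" for d
  proof -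
    have "Suc d \<in> peaks u" "d = 0 \<or> d \<in> peaks u" using that ps sm by auto
    then show False by (cases d) (auto simp: peaks_def)
  qed
  then show ?thesis unfolding peak_composition_def
    by (intro butlast_gt_1_if_psums) (auto simp: parts_pos)
qed

lemma comp_size_comp_star: "comp_size (comp_star \<beta>) = comp_size \<beta>"
  by (simp add: comp_size_def parts_comp_star sum_list_star_list parts_pos)

text \<open>Refinement is inclusion of partial sums, and the endpoints are common to both sets. A
  peak i satisfies i > 1, so i - 1 is a nonzero partial sum whenever it is one, and
  \<open>psums_star_list\<close> then supplies its successor i.\<close>

lemma refines_star_word_peak_comp:
  assumes "comp_size \<beta> = length u"
  shows "refines (comp_star \<beta>) (word_peak_comp u) \<longleftrightarrow>
    (\<forall>i\<in>peaks u. i \<in> psums (parts \<beta>) \<or> i - 1 \<in> psums (parts \<beta>))"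
proof -
  have "refines (comp_star \<beta>) (word_peak_comp u) \<longleftrightarrow> {0, length u} \<union> peaks u \<subseteq> psums (star_list (parts \<beta>))"
    using comp_of_set_parts[OF peaks_subset, of u] assms
    by (subst refines_iff_psums)
      (simp_all add: comp_size_comp_star comp_size_word_peak_comp parts_comp_star word_peak_comp_def)
  also have "\<dots> \<longleftrightarrow> peaks u \<subseteq> psums (star_list (parts \<beta>))"
    using zero_in_psums[of "star_list (parts \<beta>)"] sum_list_in_psums[of "star_list (parts \<beta>)"] assms
    by (simp add: sum_list_star_list parts_pos comp_size_def)
  also have "\<dots> \<longleftrightarrow> (\<forall>i\<in>peaks u. i \<in> psums (parts \<beta>) \<or> i - 1 \<in> psums (parts \<beta>))"
  proof -
    have "i \<in> psums (star_list (parts \<beta>)) \<longleftrightarrow> i \<in> psums (parts \<beta>) \<or> i - 1 \<in> psums (parts \<beta>)"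
      if "i \<in> peaks u" for i
    proof -
      have "1 < i" "i < sum_list (parts \<beta>)" using that assms by (auto simp: peaks_def comp_size_def)
      then obtain d where "i = Suc d" "0 < d" "d < sum_list (parts \<beta>)" by (cases i) auto
      then show ?thesis by (auto simp: psums_star_list parts_pos)
    qed
    then show ?thesis by blast
  qed
  finally show ?thesis .
qed

section \<open>Descent-free signings\<close>

text \<open>For the label word \<open>u\<close> of a chain, these are the label words of the
  descent-free paths of the doubled reseau over that chain.\<close>

definition descent_free_signings :: "int list \<Rightarrow> int list set"
  where "descent_free_signings u = {s. map abs s = u \<and> mod_descents s = {}}"

definition sign_count :: "int list \<Rightarrow> int"
  where "sign_count u = int (card (descent_free_signings u))"

lemma mod_descents_empty_iff:
  "mod_descents s = {} \<longleftrightarrow> successively (\<lambda>a b. a < b \<or> a = b \<and> 0 \<le> b) s"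
proof -
  have "mod_descents s = {} \<longleftrightarrow> (\<forall>i. Suc i \<notin> mod_descents s)"
  proof
    assume *: "\<forall>i. Suc i \<notin> mod_descents s"
    have "i \<notin> mod_descents s" for i
      using * by (cases i) (simp_all add: mod_descents_def)
    then show "mod_descents s = {}" by blast
  qed simp
  also have "\<dots> \<longleftrightarrow> successively (\<lambda>a b. a < b \<or> a = b \<and> 0 \<le> b) s"
    by (force simp: mod_descents_def successively_conv_nth)
  finally show ?thesis .
qed

lemma mod_descents_Cons_Cons:
  "mod_descents (a # b # s) = {} \<longleftrightarrow> (a < b \<or> a = b \<and> 0 \<le> b) \<and> mod_descents (b # s) = {}"
  by (simp add: mod_descents_empty_iff)

lemma mod_descents_short [simp]: "mod_descents [] = {}" "mod_descents [a] = {}"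
  by (simp_all add: mod_descents_empty_iff)

lemma finite_map_abs_eq: "finite {s. map abs s = (u :: int list)}"
proof (induction u)
  case (Cons a u)
  have "{s. map abs s = a # u} \<subseteq> (\<Union>b\<in>{- a..a}. (#) b ` {s. map abs s = u})"
    by (auto simp: Cons_eq_map_conv image_iff)
  then show ?case by (rule finite_subset) (use Cons in simp)
qed simp

lemma finite_descent_free_signings: "finite (descent_free_signings u)"
  by (rule finite_subset[OF _ finite_map_abs_eq[of u]]) (auto simp: descent_free_signings_def)

lemma descent_free_signings_Nil: "descent_free_signings [] = {[]}"
  by (auto simp: descent_free_signings_def)

lemma sign_count_Nil [simp]: "sign_count [] = 1"
  by (simp add: sign_count_def descent_free_signings_Nil)

text \<open>Descent-free words increase weakly, so a positive first letter forces every later letter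
  to be positive.\<close>

lemma descent_free_signings_hd_pos:
  assumes "\<forall>x\<in>set (a # u). 0 < x"
  shows "{s \<in> descent_free_signings (a # u). hd s = a} = (if sorted (a # u) then {a # u} else {})"
  using assms
proof (induction u arbitrary: a)
  case Nil
  then show ?case by (auto simp: descent_free_signings_def)
next
  case (Cons b u)
  have "s \<in> descent_free_signings (a # b # u) \<and> hd s = a \<longleftrightarrow>
      a \<le> b \<and> (\<exists>t \<in> {t \<in> descent_free_signings (b # u). hd t = b}. s = a # t)" for s
  proof (cases s)
    case (Cons c t)
    note s = this
    show ?thesis
    proof (cases t)
      case (Cons d t')
      show ?thesis using s Cons Cons.prems
        by (auto simp: descent_free_signings_def mod_descents_Cons_Cons abs_if split: if_splits)
    qed (use s in \<open>auto simp: descent_free_signings_def\<close>)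
  qed (auto simp: descent_free_signings_def)
  then have "{s \<in> descent_free_signings (a # b # u). hd s = a} =
      (if a \<le> b then (#) a ` {t \<in> descent_free_signings (b # u). hd t = b} else {})"
    by auto
  then show ?case using Cons.IH[of b] Cons.prems by auto
qed

text \<open>If b < a, then a positive first letter descends to either sign of b, while -a lies below
  both. If a \<le> b, then -b would create a descent after either sign of a, equal negative letters
  included; so b stays positive and the sign of a is free.\<close>

lemma descent_free_signings_Cons_Cons:
  assumes "\<forall>x\<in>set (a # b # u). 0 < x"
  shows "descent_free_signings (a # b # u) =
    (if b < a then (#) (- a) ` descent_free_signings (b # u)
     else if sorted (b # u) then {a # b # u, - a # b # u} else {})"
proof -
  have *: "s \<in> descent_free_signings (a # b # u) \<longleftrightarrow>
      (\<exists>t \<in> descent_free_signings (b # u). s = - a # t \<and> (b < a \<or> hd t = b) \<or> s = a # t \<and> a \<le> b \<and> hd t = b)" for s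
  proof (cases s)
    case (Cons c t)
    note s = this
    show ?thesis
    proof (cases t)
      case (Cons d t')
      show ?thesis using s Cons assms
        by (auto simp: descent_free_signings_def mod_descents_Cons_Cons abs_if split: if_splits)
    qed (use s in \<open>auto simp: descent_free_signings_def\<close>)
  qed (auto simp: descent_free_signings_def)
  have "descent_free_signings (a # b # u) =
    (if b < a then (#) (- a) ` descent_free_signings (b # u)
     else (#) (- a) ` {t \<in> descent_free_signings (b # u). hd t = b} \<union>
       (#) a ` {t \<in> descent_free_signings (b # u). hd t = b})"
    by (rule set_eqI, subst *) auto
  then show ?thesis using assms by (auto simp: descent_free_signings_hd_pos)
qed

lemma peaks_Cons_Cons:
  "peaks (a # b # u) = (if u \<noteq> [] \<and> a \<le> b \<and> hd u < b then {2} else {}) \<union> Suc ` peaks (b # u)"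
proof (rule set_eqI)
  fix i
  consider "i < 2" | "i = 2" | j where "i = Suc (Suc (Suc j))"
    by (metis One_nat_def Suc_1 less_2_cases_iff not0_implies_Suc)
  then show "i \<in> peaks (a # b # u) \<longleftrightarrow>
      i \<in> (if u \<noteq> [] \<and> a \<le> b \<and> hd u < b then {2} else {}) \<union> Suc ` peaks (b # u)"
    by cases (auto simp: peaks_def image_iff hd_conv_nth numeral_2_eq_2)
qed

lemma peaks_short [simp]: "peaks [] = {}" "peaks [a] = {}"
  by (auto simp: peaks_def)

text \<open>After a weak ascent, the first strict descent would create a peak.\<close>

lemma peaks_empty_ascent: "a \<le> b \<Longrightarrow> peaks (a # b # u) = {} \<longleftrightarrow> sorted (b # u)"
proof (induction u arbitrary: a b)
  case (Cons c u)
  then show ?case by (auto simp: peaks_Cons_Cons[of a] not_less)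
qed (simp add: peaks_Cons_Cons)

text \<open>A leading strict descent changes neither the count nor the absence of peaks. After a
  leading weak ascent, absence of peaks means that the rest is sorted, and the two signings differ
  in the first letter.\<close>

lemma sign_count_eq:
  assumes "\<forall>x\<in>set u. 0 < x" "u \<noteq> []"
  shows "sign_count u = (if peaks u = {} then 2 else 0)"
  using assms
proof (induction u rule: induct_list012)
  case (2 a)
  have "descent_free_signings [a] = {[a], [- a]}"
    using 2 by (auto simp: descent_free_signings_def Cons_eq_map_conv)
  then show ?case using 2 by (simp add: sign_count_def)
next
  case (3 a b u)
  show ?case
  proof (cases "b < a")
    case True
    then have "sign_count (a # b # u) = sign_count (b # u)"
      using 3 by (simp add: sign_count_def descent_free_signings_Cons_Cons card_image)
    then show ?thesis using True 3 by (simp add: peaks_Cons_Cons)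
  next
    case False
    then show ?thesis using 3(3)
      by (simp add: sign_count_def descent_free_signings_Cons_Cons peaks_empty_ascent)
  qed
qed simp

text \<open>The number of signings of \<open>u\<close> whose descents all lie at boundaries between consecutive blocks of
  lengths \<open>ks\<close>.\<close>

fun block_count :: "int list \<Rightarrow> nat list \<Rightarrow> int" where
  "block_count u [] = (if u = [] then 1 else 0)"
| "block_count u (k # ks) =
    (if k \<le> length u then sign_count (take k u) * block_count (drop k u) ks else 0)"

lemma peaks_take: "k \<le> length u \<Longrightarrow> peaks (take k u) = {i \<in> peaks u. i < k}"
  by (auto simp: peaks_def)

lemma peaks_drop: "k \<le> length u \<Longrightarrow> i \<in> peaks (drop k u) \<longleftrightarrow> 1 < i \<and> k + i \<in> peaks u"
  by (auto simp: peaks_def less_diff_conv add.commute)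

text \<open>Each nonempty block contributes the factor 2 or 0. A peak at i involves the letters i -
  1, i, i + 1; it survives inside a block unless a block ends after letter i or begins with letter
  i, that is, unless i or i - 1 is a partial sum.\<close>

lemma block_count_eq:
  assumes "0 \<notin> set ks" "\<forall>x\<in>set u. 0 < x"
  shows "block_count u ks =
    (if sum_list ks = length u \<and> (\<forall>i\<in>peaks u. i \<in> psums ks \<or> i - 1 \<in> psums ks)
     then 2 ^ length ks else 0)"
  using assms
proof (induction ks arbitrary: u)
  case Nil
  then show ?case by auto
next
  case (Cons k ks)
  show ?case
  proof (cases "k \<le> length u")
    case True
    have k: "0 < k" using Cons.prems by (cases k) auto
    have gt: "1 < i" if "i \<in> peaks u" for i using that by (auto simp: peaks_def)
    have "(\<forall>i\<in>peaks u. i \<in> psums (k # ks) \<or> i - 1 \<in> psums (k # ks)) \<longleftrightarrow>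
        peaks (take k u) = {} \<and> (\<forall>i\<in>peaks (drop k u). i \<in> psums ks \<or> i - 1 \<in> psums ks)"
      (is "?L \<longleftrightarrow> ?R")
    proof
      assume L: ?L
      have False if "i \<in> peaks u" "i < k" for i
        using L that gt[OF that(1)] by (fastforce simp: image_iff)
      moreover have "i \<in> psums ks \<or> i - 1 \<in> psums ks" if "i \<in> peaks (drop k u)" for i
      proof -
        have "1 < i" "k + i \<in> peaks u" using that True by (auto simp: peaks_drop)
        with L have "k + i \<in> psums (k # ks) \<or> k + i - 1 \<in> psums (k # ks)" by blast
        with \<open>1 < i\<close> k show ?thesis by (cases i) (auto simp: image_iff)
      qed
      ultimately show ?R using True by (auto simp: peaks_take)
    next
      assume R: ?R
      show ?L
      proof
        fix i assume i: "i \<in> peaks u"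
        then have "k \<le> i" using R True by (auto simp: peaks_take)
        then obtain j where j: "i = k + j" using le_Suc_ex by blast
        show "i \<in> psums (k # ks) \<or> i - 1 \<in> psums (k # ks)"
        proof (cases "1 < j")
          case True
          then have "j \<in> psums ks \<or> j - 1 \<in> psums ks"
            using R i j \<open>k \<le> length u\<close> by (auto simp: peaks_drop)
          then show ?thesis using j True by (cases j) (auto simp: image_iff)
        next
          case False
          \<comment> \<open>A peak at k or k + 1 is broken by the block boundary at k.\<close>
          then have "j = 0 \<or> j = 1" by auto
          then show ?thesis using j zero_in_psums[of ks] by (auto simp: image_iff)
        qed
      qed
    qed
    moreover have "sign_count (take k u) = (if peaks (take k u) = {} then 2 else 0)"
      using Cons.prems True k by (intro sign_count_eq) (auto dest: in_set_takeD)
    moreover have "block_count (drop k u) ks =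
      (if sum_list ks = length u - k \<and> (\<forall>i\<in>peaks (drop k u). i \<in> psums ks \<or> i - 1 \<in> psums ks)
       then 2 ^ length ks else 0)"
      using Cons.prems by (subst Cons.IH) (auto dest: in_set_dropD)
    ultimately show ?thesis using True by (auto simp del: psums.simps)
  next
    case False
    then show ?thesis by (auto simp del: psums.simps)
  qed
qed

section \<open>Coefficients of the peak functions\<close>

lemma finite_compositions: "finite {\<beta>. comp_size \<beta> = n}"
proof -
  have "length bs \<le> sum_list bs" if "0 \<notin> set bs" for bs :: "nat list"
    using that by (induction bs) (auto simp: Suc_le_eq intro: add_le_mono)
  then have "parts ` {\<beta>. comp_size \<beta> = n} \<subseteq> {bs. set bs \<subseteq> {..n} \<and> length bs \<le> n}"
    using parts_pos by (auto simp: comp_size_def intro: member_le_sum_list)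
  then have "finite (parts ` {\<beta>. comp_size \<beta> = n})"
    by (rule finite_subset) (simp add: finite_lists_length_le)
  then show ?thesis
    by (rule finite_imageD) (simp add: inj_on_def parts_inject)
qed

lemma sum_fun_apply: "(\<Sum>i\<in>I. f i) x = (\<Sum>i\<in>I. f i x)"
  by (induction I rule: infinite_finite_induct) auto

lemma qsym_theta_frag_of:
  "qsym_theta \<alpha> (frag_of \<beta>) =
    (if comp_size \<beta> = comp_size \<alpha> \<and> refines (comp_star \<beta>) \<alpha> then 2 ^ length (parts \<beta>) else 0)"
proof -
  let ?B = "{\<beta>. comp_size \<beta> = comp_size \<alpha> \<and> refines (comp_star \<beta>) \<alpha>}"
  \<comment> \<open>Finiteness is essential here: a sum over an infinite set would be 0 by
    convention.\<close>
  have "finite ?B" by (rule finite_subset[OF _ finite_compositions]) auto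
  moreover have "qsym_theta \<alpha> (frag_of \<beta>) = (\<Sum>\<gamma>\<in>?B. if \<gamma> = \<beta> then 2 ^ length (parts \<beta>) else 0)"
    by (auto simp: qsym_theta_def sum_fun_apply qsym_M_def lookup_single when_def intro!: sum.cong)
  ultimately show ?thesis by simp
qed

text \<open>The bridge from peak functions to the doubled reseau: the coefficients of the peak
  function of a word count signings. Both sides vanish at compositions of the wrong size.\<close>

lemma qsym_theta_word_peak_comp:
  assumes "\<forall>x\<in>set u. 0 < x"
  shows "qsym_theta (word_peak_comp u) (frag_of \<beta>) = block_count u (parts \<beta>)"
  using assms refines_star_word_peak_comp[of \<beta> u]
  by (simp add: qsym_theta_frag_of block_count_eq parts_pos comp_size_word_peak_comp
      flip: comp_size_def) blast

section \<open>Shuffles\<close>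

text \<open>Turns membership in a set of shuffles into equations between filtered lists whenever a
  predicate separates the alphabets.\<close>

lemma mem_shuffles_iff_filter:
  assumes "\<forall>x\<in>set xs. P x" "\<forall>y\<in>set ys. \<not> P y"
  shows "zs \<in> shuffles xs ys \<longleftrightarrow> filter P zs = xs \<and> filter (\<lambda>x. \<not> P x) zs = ys"
proof
  assume zs: "zs \<in> shuffles xs ys"
  have "filter P zs \<in> shuffles (filter P xs) (filter P ys)"
    "filter (\<lambda>x. \<not> P x) zs \<in> shuffles (filter (\<lambda>x. \<not> P x) xs) (filter (\<lambda>x. \<not> P x) ys)"
    using zs by (auto simp flip: filter_shuffles)
  then show "filter P zs = xs \<and> filter (\<lambda>x. \<not> P x) zs = ys"
    using assms by (simp add: filter_empty_conv filter_id_conv)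
qed (use partition_in_shuffles[of zs P] in auto)

text \<open>Unlike a condition on adjacent letters, this form is visibly compatible with sorting and
  with passing to subwords.\<close>

lemma mod_descents_empty_iff_sorted:
  "mod_descents s = {} \<longleftrightarrow> sorted s \<and> distinct (filter (\<lambda>x. x < 0) s)"
proof (induction s rule: induct_list012)
  case (3 a b s)
  then show ?case by (auto simp: mod_descents_Cons_Cons) force+
qed auto

text \<open>Separating a signed shuffle by absolute values and sorting the concatenation of two
  signings are mutually inverse. Disjointness of the alphabets keeps the negative letters of the
  sorted word distinct.\<close>

lemma sign_count_mult:
  assumes "set u \<inter> set v = {}"
  shows "sign_count u * sign_count v = (\<Sum>w\<in>shuffles u v. sign_count w)"
proof -
  let ?D = descent_free_signings
  let ?P = "\<lambda>x. \<bar>x\<bar> \<in> set u"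
  have mem: "w \<in> shuffles u v \<longleftrightarrow> filter (\<lambda>x. x \<in> set u) w = u \<and> filter (\<lambda>x. x \<notin> set u) w = v" for w
    using assms by (intro mem_shuffles_iff_filter) auto
  have D: "s \<in> ?D w \<longleftrightarrow> map abs s = w \<and> sorted s \<and> distinct (filter (\<lambda>x. x < 0) s)" for s w
    by (simp add: descent_free_signings_def mod_descents_empty_iff_sorted)
  have merge: "filter ?P (sort (s @ t)) = s" "filter (\<lambda>x. \<not> ?P x) (sort (s @ t)) = t"
    if "s \<in> ?D u" "t \<in> ?D v" for s t
  proof -
    have "\<forall>x\<in>set s. ?P x" "\<forall>x\<in>set t. \<not> ?P x" using that assms by (auto simp: D)
    then have "filter ?P (s @ t) = s" "filter (\<lambda>x. \<not> ?P x) (s @ t) = t"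
      by (simp_all add: filter_empty_conv filter_id_conv)
    moreover have "sorted s" "sorted t" using that by (auto simp: D)
    ultimately show "filter ?P (sort (s @ t)) = s" "filter (\<lambda>x. \<not> ?P x) (sort (s @ t)) = t"
      by (simp_all add: filter_sort sorted_sort_id)
  qed
  have "bij_betw (\<lambda>r. (filter ?P r, filter (\<lambda>x. \<not> ?P x) r)) (\<Union>w\<in>shuffles u v. ?D w) (?D u \<times> ?D v)"
  proof (rule bij_betw_byWitness[where f' = "\<lambda>(s, t). sort (s @ t)"])
    show "\<forall>r\<in>\<Union>w\<in>shuffles u v. ?D w.
        (\<lambda>(s, t). sort (s @ t)) (filter ?P r, filter (\<lambda>x. \<not> ?P x) r) = r"
      by (auto simp: D intro!: properties_for_sort)
    show "\<forall>p\<in>?D u \<times> ?D v. (filter ?P ((\<lambda>(s, t). sort (s @ t)) p),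
        filter (\<lambda>x. \<not> ?P x) ((\<lambda>(s, t). sort (s @ t)) p)) = p"
      using merge by auto
    show "(\<lambda>r. (filter ?P r, filter (\<lambda>x. \<not> ?P x) r)) ` (\<Union>w\<in>shuffles u v. ?D w) \<subseteq> ?D u \<times> ?D v"
    proof safe
      fix r w assume w: "w \<in> shuffles u v" and r: "r \<in> ?D w"
      have comm: "distinct (filter (\<lambda>x. x < 0) (filter Q r))" for Q
      proof -
        have "filter (\<lambda>x. x < 0) (filter Q r) = filter Q (filter (\<lambda>x. x < 0) r)"
          by (simp add: conj_commute)
        then show ?thesis using r by (simp only: D distinct_filter)
      qed
      show "filter ?P r \<in> ?D u" "filter (\<lambda>x. \<not> ?P x) r \<in> ?D v"
        using r w comm by (auto simp: D mem filter_map o_def sorted_filter[of id, simplified] simp del: filter_filter)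
    qed
    show "(\<lambda>(s, t). sort (s @ t)) ` (?D u \<times> ?D v) \<subseteq> (\<Union>w\<in>shuffles u v. ?D w)"
    proof safe
      fix s t assume s: "s \<in> ?D u" and t: "t \<in> ?D v"
      have "map abs (sort (s @ t)) \<in> shuffles u v"
        using merge[OF s t] s t by (simp add: mem filter_map o_def D)
      moreover have "distinct (filter (\<lambda>x. x < 0) (sort (s @ t)))"
      proof -
        have "set s \<inter> set t = {}" using s t assms by (fastforce simp: D disjoint_iff)
        then show ?thesis using s t by (auto simp: filter_sort D)
      qed
      ultimately show "sort (s @ t) \<in> (\<Union>w\<in>shuffles u v. ?D w)"
        by (auto simp: D)
    qed
  qed
  then have "card (\<Union>w\<in>shuffles u v. ?D w) = card (?D u) * card (?D v)"
    by (simp add: bij_betw_same_card card_cartesian_product)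
  \<comment> \<open>The union is disjoint because a signing \<open>r\<close> determines its word as
    \<open>map abs r\<close>.\<close>
  moreover have "card (\<Union>w\<in>shuffles u v. ?D w) = (\<Sum>w\<in>shuffles u v. card (?D w))"
    by (rule card_UN_disjoint) (auto simp: finite_descent_free_signings D)
  ultimately show ?thesis
    by (simp add: sign_count_def flip: of_nat_mult of_nat_sum)
qed

text \<open>Cutting a shuffle after k letters leaves a shuffle of prefixes and a shuffle of
  suffixes. The index i is the number of letters of \<open>u\<close> among the first k, which the
  disjoint alphabets make recoverable.\<close>

lemma sum_shuffles_split:
  assumes "set u \<inter> set v = {}"
  shows "(\<Sum>w | w \<in> shuffles u v \<and> k \<le> length w. g (take k w) (drop k w)) =
    (\<Sum>i | i \<le> k \<and> i \<le> length u \<and> k - i \<le> length v.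
      \<Sum>w1\<in>shuffles (take i u) (take (k - i) v). \<Sum>w2\<in>shuffles (drop i u) (drop (k - i) v). g w1 w2)"
proof -
  let ?P = "\<lambda>x. x \<in> set u"
  let ?I = "{i. i \<le> k \<and> i \<le> length u \<and> k - i \<le> length v}"
  let ?S = "\<lambda>i. shuffles (take i u) (take (k - i) v) \<times> shuffles (drop i u) (drop (k - i) v)"
  have mem: "w \<in> shuffles u' v' \<longleftrightarrow> filter ?P w = u' \<and> filter (\<lambda>x. \<not> ?P x) w = v'"
    if "set u' \<subseteq> set u" "set v' \<subseteq> set v" for u' v' w
    using assms that by (intro mem_shuffles_iff_filter) auto
  have mem_take: "w \<in> shuffles (take i u) (take j v) \<longleftrightarrow>
      filter ?P w = take i u \<and> filter (\<lambda>x. \<not> ?P x) w = take j v" for i j w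
    by (rule mem) (auto dest: in_set_takeD)
  have mem_drop: "w \<in> shuffles (drop i u) (drop j v) \<longleftrightarrow>
      filter ?P w = drop i u \<and> filter (\<lambda>x. \<not> ?P x) w = drop j v" for i j w
    by (rule mem) (auto dest: in_set_dropD)
  have mem_all: "w \<in> shuffles u v \<longleftrightarrow> filter ?P w = u \<and> filter (\<lambda>x. \<not> ?P x) w = v" for w
    by (rule mem) auto
  have "(\<Sum>w | w \<in> shuffles u v \<and> k \<le> length w. g (take k w) (drop k w)) =
      (\<Sum>(i, w1, w2)\<in>Sigma ?I ?S. g w1 w2)"
  proof (rule sum.reindex_bij_witness[where
        j = "\<lambda>w. (length (filter ?P (take k w)), take k w, drop k w)" and i = "\<lambda>(i, w1, w2). w1 @ w2"])
    fix w assume "w \<in> {w. w \<in> shuffles u v \<and> k \<le> length w}"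
    then have w: "filter ?P w = u" "filter (\<lambda>x. \<not> ?P x) w = v" and k: "k \<le> length w"
      by (auto simp: mem_all)
    define i where "i = length (filter ?P (take k w))"
    have ki: "length (filter (\<lambda>x. \<not> ?P x) (take k w)) = k - i" and "i \<le> k"
      using sum_length_filter_compl[of ?P "take k w"] k by (auto simp: i_def)
    have "u = filter ?P (take k w) @ filter ?P (drop k w)"
      "v = filter (\<lambda>x. \<not> ?P x) (take k w) @ filter (\<lambda>x. \<not> ?P x) (drop k w)"
      using w by (simp_all flip: filter_append)
    then have "filter ?P (take k w) = take i u" "filter ?P (drop k w) = drop i u"
      "filter (\<lambda>x. \<not> ?P x) (take k w) = take (k - i) v"
      "filter (\<lambda>x. \<not> ?P x) (drop k w) = drop (k - i) v" "i \<le> length u" "k - i \<le> length v"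
      using i_def ki
      by (metis append_eq_conv_conj length_append le_add1)+
    then show "(length (filter ?P (take k w)), take k w, drop k w) \<in> Sigma ?I ?S"
      using \<open>i \<le> k\<close> by (simp add: mem_take mem_drop flip: i_def)
  next
    fix p assume "p \<in> Sigma ?I ?S"
    then obtain i w1 w2 where p: "p = (i, w1, w2)" and i: "i \<in> ?I"
      and w1: "w1 \<in> shuffles (take i u) (take (k - i) v)"
      and w2: "w2 \<in> shuffles (drop i u) (drop (k - i) v)" by auto
    have len: "length w1 = k" using i length_shuffles[OF w1] by simp
    have f: "length (filter ?P w1) = i" using w1 i by (simp add: mem_take)
    show "(\<lambda>w. (length (filter ?P (take k w)), take k w, drop k w)) (case p of (i, w1, w2) \<Rightarrow> w1 @ w2) = p"
      using len f by (simp add: p)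
    show "(case p of (i, w1, w2) \<Rightarrow> w1 @ w2) \<in> {w. w \<in> shuffles u v \<and> k \<le> length w}"
      using w1 w2 len by (simp add: p mem_take mem_drop mem_all)
  qed auto
  also have "\<dots> = (\<Sum>i\<in>?I. \<Sum>p\<in>?S i. case p of (w1, w2) \<Rightarrow> g w1 w2)"
    by (subst sum.Sigma) (auto intro: finite_subset[of _ "{..k}"])
  finally show ?thesis by (simp add: sum.cartesian_product)
qed

text \<open>Linear extension with values in the integers, identified with the free abelian group on
  the single generator \<open>()\<close>.\<close>

definition frag_lin :: "('a \<Rightarrow> int) \<Rightarrow> ('a \<Rightarrow>\<^sub>0 int) \<Rightarrow> int"
  where "frag_lin f u = Poly_Mapping.lookup (frag_extend (\<lambda>a. frag_cmul (f a) (frag_of ())) u) ()"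

lemma frag_lin_of [simp]: "frag_lin f (frag_of a) = f a"
  by (simp add: frag_lin_def)

lemma frag_lin_zero [simp]: "frag_lin f 0 = 0"
  by (simp add: frag_lin_def)

lemma frag_lin_add: "frag_lin f (u + v) = frag_lin f u + frag_lin f v"
  by (simp add: frag_lin_def frag_extend_add lookup_add)

lemma frag_lin_minus: "frag_lin f (- u) = - frag_lin f u"
  by (simp add: frag_lin_def frag_extend_minus)

lemma frag_lin_sum: "frag_lin f (\<Sum>i\<in>I. g i) = (\<Sum>i\<in>I. frag_lin f (g i))"
  by (induction I rule: infinite_finite_induct) (simp_all add: frag_lin_add)

lemma frag_lin_frag_of_mult:
  "frag_lin f (frag_of p * u) = frag_lin (\<lambda>q. f (p + q)) (u :: 'a::monoid_add \<Rightarrow>\<^sub>0 int)"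
  by (induction u rule: frag_add_induct)
    (simp_all add: mult_single frag_lin_add frag_lin_minus distrib_left)

lemma frag_lin_cmult: "frag_lin (\<lambda>a. c * f a) u = c * frag_lin f u"
  by (induction u rule: frag_add_induct) (simp_all add: frag_lin_add frag_lin_minus distrib_left)

section \<open>Block counts and the coproduct of NC\<close>

lemma nc_gen_eq_frag_of: "nc_gen k = frag_of (Composition (if k = 0 then [] else [k]))"
  by (simp add: nc_gen_def flip: single_one zero_composition_def)

text \<open>For k = 0 no block is added, and the right-hand side agrees because
  \<open>sign_count [] = 1\<close>.\<close>

lemma block_count_plus:
  "block_count u (parts (Composition (if k = 0 then [] else [k]) + \<beta>)) =
    (if k \<le> length u then sign_count (take k u) * block_count (drop k u) (parts \<beta>) else 0)"
  by (simp add: parts_plus parts_Composition)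

text \<open>The sum over \<open>i \<le> k\<close> from the coproduct of \<open>h\<^sub>k\<close> distributes the first \<open>k\<close> letters of a shuffle
  among the two words.\<close>

lemma coproduct_block_count:
  assumes "set u \<inter> set v = {}"
  shows "frag_lin (\<lambda>(\<beta>, \<gamma>). block_count u (parts \<beta>) * block_count v (parts \<gamma>))
      (\<Prod>k\<leftarrow>ks. \<Sum>i\<le>k. frag_bilin Pair (nc_gen i) (nc_gen (k - i))) =
    (\<Sum>w\<in>shuffles u v. block_count w ks)"
  using assms
proof (induction ks arbitrary: u v)
  case Nil
  have "(\<Sum>w\<in>shuffles u v. block_count w []) = (\<Sum>w\<in>shuffles u v. if w = [] then 1 else 0)"
    by simp
  \<comment> \<open>The empty word is a shuffle of \<open>u\<close> and \<open>v\<close> only if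
    both are empty.\<close>
  also have "\<dots> = block_count u [] * block_count v []"
    by (subst sum.delta) auto
  finally show ?case
    by (simp add: zero_prod_def parts_zero flip: single_one)
next
  case (Cons k ks)
  let ?R = "\<Prod>k\<leftarrow>ks. \<Sum>i\<le>k. frag_bilin Pair (nc_gen i) (nc_gen (k - i))"
  let ?I = "{i. i \<le> k \<and> i \<le> length u \<and> k - i \<le> length v}"
  have "frag_lin (\<lambda>(\<beta>, \<gamma>). block_count u (parts \<beta>) * block_count v (parts \<gamma>))
      (frag_bilin Pair (nc_gen i) (nc_gen (j)) * ?R) =
      (if i \<le> length u \<and> j \<le> length v
       then \<Sum>w1\<in>shuffles (take i u) (take (j) v). \<Sum>w2\<in>shuffles (drop i u) (drop (j) v).
         sign_count w1 * block_count w2 ks else 0)" for i j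
  proof (cases "i \<le> length u \<and> j \<le> length v")
    case False
    \<comment> \<open>A first block longer than its word makes the whole functional vanish.\<close>
    have "frag_lin (\<lambda>_. 0) ?R = 0" using frag_lin_cmult[of 0 "\<lambda>_. 0" ?R] by simp
    with False show ?thesis
      by (auto simp: nc_gen_eq_frag_of frag_bilin_def frag_lin_frag_of_mult block_count_plus
          case_prod_unfold)
  next
    case True
    have disj: "set (take i u) \<inter> set (take (j) v) = {}" "set (drop i u) \<inter> set (drop (j) v) = {}"
      using Cons.prems by (auto dest: in_set_takeD in_set_dropD)
    have "frag_lin (\<lambda>(\<beta>, \<gamma>). block_count u (parts \<beta>) * block_count v (parts \<gamma>))
        (frag_bilin Pair (nc_gen i) (nc_gen (j)) * ?R) =
      frag_lin (\<lambda>p. sign_count (take i u) * sign_count (take (j) v) *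
        (case p of (\<beta>, \<gamma>) \<Rightarrow> block_count (drop i u) (parts \<beta>) * block_count (drop (j) v) (parts \<gamma>))) ?R"
      using True
      by (simp add: nc_gen_eq_frag_of frag_bilin_def frag_lin_frag_of_mult block_count_plus
          case_prod_unfold mult_ac)
    \<comment> \<open>The prefixes are merged by \<open>sign_count_mult\<close>, the suffixes by the
      induction hypothesis.\<close>
    also have "\<dots> = (\<Sum>w1\<in>shuffles (take i u) (take (j) v). sign_count w1) *
        (\<Sum>w2\<in>shuffles (drop i u) (drop (j) v). block_count w2 ks)"
      by (simp only: frag_lin_cmult sign_count_mult[OF disj(1)] Cons.IH[OF disj(2)])
    finally show ?thesis using True by (simp add: sum_product)
  qed
  then have "frag_lin (\<lambda>(\<beta>, \<gamma>). block_count u (parts \<beta>) * block_count v (parts \<gamma>))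
      (\<Prod>k\<leftarrow>k # ks. \<Sum>i\<le>k. frag_bilin Pair (nc_gen i) (nc_gen (k - i))) =
      (\<Sum>i\<le>k. if i \<le> length u \<and> k - i \<le> length v
       then \<Sum>w1\<in>shuffles (take i u) (take (k - i) v). \<Sum>w2\<in>shuffles (drop i u) (drop (k - i) v).
         sign_count w1 * block_count w2 ks else 0)"
    by (simp add: sum_distrib_right frag_lin_sum)
  also have "\<dots> = (\<Sum>i\<in>?I.
       \<Sum>w1\<in>shuffles (take i u) (take (k - i) v). \<Sum>w2\<in>shuffles (drop i u) (drop (k - i) v).
         sign_count w1 * block_count w2 ks)"
    by (intro sum.mono_neutral_cong_right) auto
  also have "\<dots> = (\<Sum>w | w \<in> shuffles u v \<and> k \<le> length w. sign_count (take k w) * block_count (drop k w) ks)"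
    using sum_shuffles_split[OF Cons.prems, of "\<lambda>w1 w2. sign_count w1 * block_count w2 ks" k] by simp
  \<comment> \<open>Shuffles shorter than k may be included again, as their block count is
    0.\<close>
  also have "\<dots> = (\<Sum>w\<in>shuffles u v. block_count w (k # ks))"
    by (intro sum.mono_neutral_cong_left) auto
  finally show ?case .
qed

section \<open>Paths in the doubled reseau\<close>

lemma chain_labels_simps [simp]:
  "chain_labels lab [x] = []"
  "chain_labels lab (x # y # xs) = lab x y # chain_labels lab (y # xs)"
  by (simp_all add: chain_labels_def)

lemma length_chain_labels: "length (chain_labels lab (x # xs)) = length xs"
  by (simp add: chain_labels_def)

lemma chain_labels_eq_Nil_iff: "chain_labels lab (x # xs) = [] \<longleftrightarrow> xs = []"
  by (cases xs) simp_all

lemma chain_labels_append: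
  "chain_labels lab (x # xs @ ys) = chain_labels lab (x # xs) @ chain_labels lab (last (x # xs) # ys)"
  by (induction xs arbitrary: x) auto

lemma successively_Cons_append:
  "successively R (x # xs @ ys) \<longleftrightarrow> successively R (x # xs) \<and> successively R (last (x # xs) # ys)"
  by (induction xs arbitrary: x) auto

text \<open>Chains are represented without their first element, so that concatenation is \<open>@\<close>.\<close>

definition upward_steps :: "nat \<Rightarrow> 'a::order \<Rightarrow> 'a list set"
  where "upward_steps k x = {xs. length xs = k \<and> successively (\<lessdot>) (x # xs)}"

definition chain_tails :: "'a::order \<Rightarrow> 'a \<Rightarrow> 'a list set"
  where "chain_tails x y = {xs. successively (\<lessdot>) (x # xs) \<and> last (x # xs) = y}"

lemma sat_chains_eq: "sat_chains x y = (#) x ` chain_tails x y"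
proof (rule set_eqI)
  fix \<omega>
  show "\<omega> \<in> sat_chains x y \<longleftrightarrow> \<omega> \<in> (#) x ` chain_tails x y"
    by (cases \<omega>) (auto simp: sat_chains_def chain_tails_def)
qed

text \<open>Linearity in the starting vector: this reduces the action after the first operator to
  its values on vertices.\<close>

lemma foldl_frag_extend:
  "foldl (\<lambda>w k. frag_extend (H k) w) w ks =
    frag_extend (\<lambda>x. foldl (\<lambda>w k. frag_extend (H k) w) (frag_of x) ks) w"
proof (induction ks arbitrary: w)
  case Nil
  show ?case by (simp flip: frag_expansion)
next
  case (Cons k ks)
  have "frag_extend G (frag_extend (H k) w) = frag_extend (\<lambda>x. frag_extend G (H k x)) w"
    for G :: "'a \<Rightarrow> 'a \<Rightarrow>\<^sub>0 int"
    by (induction w rule: frag_add_induct) (simp_all add: frag_extend_add frag_extend_minus)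
  then show ?case
    using Cons.IH[of "frag_extend (H k) w"] Cons.IH[of "H k _"] by simp
qed

context labelled_poset
begin

lemma finite_upward_steps: "finite (upward_steps k (x :: 'a))"
proof (induction k arbitrary: x)
  case 0
  show ?case by (rule finite_subset[of _ "{[]}"]) (auto simp: upward_steps_def)
next
  case (Suc k)
  have "upward_steps (Suc k) x \<subseteq> (\<Union>y\<in>{y. x \<lessdot> y}. (#) y ` upward_steps k y)"
    by (auto simp: upward_steps_def length_Suc_conv image_iff)
  then show ?case
    by (rule finite_subset) (use Suc finite_upper_covers in auto)
qed

text \<open>The rank difference fixes the length of a saturated chain, and finiteness of upper
  covers leaves finitely many of that length.\<close>

lemma finite_chain_tails: "finite (chain_tails x (y :: 'a))"
proof -
  obtain rk :: "'a \<Rightarrow> int" where rk: "\<And>x y. x \<lessdot> y \<Longrightarrow> rk y = rk x + 1"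
    using graded by blast
  have "rk (last (x # xs)) = rk x + int (length xs)" if "successively (\<lessdot>) (x # xs)" for x xs
    using that by (induction xs arbitrary: x) (auto simp: rk)
  then have "chain_tails x y \<subseteq> upward_steps (nat (rk y - rk x)) x"
    by (fastforce simp: chain_tails_def upward_steps_def simp del: last.simps)
  then show ?thesis using finite_upward_steps finite_subset by blast
qed

lemma chain_labels_pos:
  "successively (\<lessdot>) (x # xs) \<Longrightarrow> \<forall>b\<in>set (chain_labels lab (x # xs)). 0 < b"
  by (induction xs arbitrary: x) (auto simp: lab_pos)

text \<open>A path is a chain with a signing of its labels: by positivity, the two arcs over a cover
  are those whose label has the right absolute value. As \<open>zip\<close> drops the last entry of
  \<open>x # ys\<close>, the tails are \<open>x\<close> followed by all heads but the last.\<close>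

lemma awalk_doubled_reseau_iff:
  "(\<exists>z. pre_digraph.awalk (doubled_reseau lab) x \<omega> z) \<longleftrightarrow>
    (let ys = map (snd \<circ> snd) \<omega> in
      \<omega> = zip (x # ys) (zip (path_labels \<omega>) ys) \<and> successively (\<lessdot>) (x # ys) \<and>
      map abs (path_labels \<omega>) = chain_labels lab (x # ys))"
proof (induction \<omega> arbitrary: x)
  case Nil
  show ?case
    by (simp add: pre_digraph.awalk_def pre_digraph.cas.simps doubled_reseau_def path_labels_def)
next
  case (Cons e \<omega>)
  obtain t b h where e: "e = (t, b, h)" by (cases e)
  have "(b = lab x h \<or> b = - lab x h) \<longleftrightarrow> \<bar>b\<bar> = lab x h" if "x \<lessdot> h"
    using lab_pos[OF that] by auto
  then have "(\<exists>z. pre_digraph.awalk (doubled_reseau lab) x (e # \<omega>) z) \<longleftrightarrow>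
      t = x \<and> x \<lessdot> h \<and> \<bar>b\<bar> = lab x h \<and> (\<exists>z. pre_digraph.awalk (doubled_reseau lab) h \<omega> z)"
    by (auto simp: pre_digraph.awalk_def pre_digraph.cas.simps doubled_reseau_def e)
  then show ?case
    by (auto simp: Cons.IH e path_labels_def Let_def)
qed

lemma awlast_doubled_reseau:
  "pre_digraph.awalk (doubled_reseau lab) x \<omega> z \<Longrightarrow>
    last (pre_digraph.awalk_verts (doubled_reseau lab) x \<omega>) = last (x # map (snd \<circ> snd) \<omega>)"
proof (induction \<omega> arbitrary: x)
  case (Cons e \<omega>)
  then show ?case
    by (cases e)
      (simp add: pre_digraph.awalk_def pre_digraph.cas.simps pre_digraph.awalk_verts.simps
        pre_digraph.awalk_verts_non_Nil doubled_reseau_def)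
qed (simp add: pre_digraph.awalk_verts.simps)

text \<open>Groups the descent-free paths by their underlying chain; each fibre is a set of
  descent-free signings.\<close>

lemma mod_descent_pieri_eq:
  "mod_descent_pieri lab k x = (\<Sum>xs\<in>upward_steps k x.
    frag_cmul (sign_count (chain_labels lab (x # xs))) (frag_of (last (x # xs))))"
proof -
  let ?W = "{\<omega>. (\<exists>z. pre_digraph.awalk (doubled_reseau lab) x \<omega> z) \<and> length \<omega> = k \<and>
    mod_descents (path_labels \<omega>) = {}}"
  let ?D = "\<lambda>xs. descent_free_signings (chain_labels lab (x # xs))"
  have "mod_descent_pieri lab k x =
      (\<Sum>(xs, s)\<in>Sigma (upward_steps k x) ?D. frag_of (last (x # xs)))"
    unfolding mod_descent_pieri_def
  proof (rule sum.reindex_bij_witness[where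
        j = "\<lambda>\<omega>. (map (snd \<circ> snd) \<omega>, path_labels \<omega>)" and i = "\<lambda>(xs, s). zip (x # xs) (zip s xs)"])
    fix \<omega> assume \<omega>: "\<omega> \<in> ?W"
    then show "(\<lambda>(xs, s). zip (x # xs) (zip s xs)) (map (snd \<circ> snd) \<omega>, path_labels \<omega>) = \<omega>"
      by (simp add: awalk_doubled_reseau_iff Let_def)
    show "(map (snd \<circ> snd) \<omega>, path_labels \<omega>) \<in> Sigma (upward_steps k x) ?D"
      using \<omega> by (simp add: awalk_doubled_reseau_iff Let_def upward_steps_def descent_free_signings_def)
    show "(\<lambda>(xs, s). frag_of (last (x # xs))) (map (snd \<circ> snd) \<omega>, path_labels \<omega>) =
        frag_of (last (pre_digraph.awalk_verts (doubled_reseau lab) x \<omega>))"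
      using \<omega> awlast_doubled_reseau by fastforce
  next
    fix p assume "p \<in> Sigma (upward_steps k x) ?D"
    then obtain xs s where p: "p = (xs, s)" and xs: "xs \<in> upward_steps k x" and s: "s \<in> ?D xs"
      by auto
    have "length (map abs s) = length xs" "length xs = k"
      using xs s by (auto simp: descent_free_signings_def length_chain_labels upward_steps_def)
    then have len: "length s = length xs" "length xs = k" by auto
    have inv: "map (snd \<circ> snd) (zip (x # xs) (zip s xs)) = xs" "path_labels (zip (x # xs) (zip s xs)) = s"
    proof -
      have "map (snd \<circ> snd) (zip (x # xs) (zip s xs)) = map snd (map snd (zip (x # xs) (zip s xs)))"
        by simp
      also have "\<dots> = xs" using len by (simp add: map_snd_zip_take)
      finally show "map (snd \<circ> snd) (zip (x # xs) (zip s xs)) = xs" .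
      have "path_labels (zip (x # xs) (zip s xs)) = map fst (map snd (zip (x # xs) (zip s xs)))"
        by (simp add: path_labels_def case_prod_unfold)
      also have "\<dots> = s" using len by (simp add: map_snd_zip_take)
      finally show "path_labels (zip (x # xs) (zip s xs)) = s" .
    qed
    show "(\<lambda>\<omega>. (map (snd \<circ> snd) \<omega>, path_labels \<omega>)) (case p of (xs, s) \<Rightarrow> zip (x # xs) (zip s xs)) = p"
      using inv by (simp add: p)
    show "(case p of (xs, s) \<Rightarrow> zip (x # xs) (zip s xs)) \<in> ?W"
      using xs s len unfolding p mem_Collect_eq awalk_doubled_reseau_iff Let_def prod.case inv
      by (simp add: upward_steps_def descent_free_signings_def)
  qed
  also have "\<dots> = (\<Sum>xs\<in>upward_steps k x. \<Sum>s\<in>?D xs. frag_of (last (x # xs)))"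
    by (subst sum.Sigma) (auto simp: finite_upward_steps finite_descent_free_signings)
  also have "\<dots> = (\<Sum>xs\<in>upward_steps k x.
      frag_cmul (sign_count (chain_labels lab (x # xs))) (frag_of (last (x # xs))))"
  proof -
    have "(\<Sum>s\<in>S. c) = frag_cmul (int (card S)) c" if "finite S" for S :: "int list set" and c :: "'a \<Rightarrow>\<^sub>0 int"
      using that by (induction S) (auto simp: frag_cmul_distrib)
    then show ?thesis by (simp add: finite_descent_free_signings sign_count_def)
  qed
  finally show ?thesis .
qed

text \<open>The operator applied first consumes the first k steps of a chain, just as
  \<open>block_count\<close> consumes the first k letters of its label word.\<close>

lemma lookup_foldl_pieri:
  "Poly_Mapping.lookup (foldl (\<lambda>w k. frag_extend (mod_descent_pieri lab k) w) (frag_of x) ks) y =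
    (\<Sum>xs\<in>chain_tails x y. block_count (chain_labels lab (x # xs)) ks)"
proof (induction ks arbitrary: x)
  case Nil
  have "(\<Sum>xs\<in>chain_tails x y. block_count (chain_labels lab (x # xs)) []) =
      (\<Sum>xs\<in>chain_tails x y. if xs = [] then 1 else 0)"
    by (intro sum.cong) (simp_all add: chain_labels_eq_Nil_iff)
  also have "\<dots> = (if x = y then 1 else 0)"
    by (subst sum.delta[OF finite_chain_tails]) (simp add: chain_tails_def)
  finally show ?case by (simp add: lookup_single when_def)
next
  case (Cons k ks)
  let ?G = "\<lambda>x. foldl (\<lambda>w k. frag_extend (mod_descent_pieri lab k) w) (frag_of x) ks"
  let ?c = "\<lambda>xs. sign_count (chain_labels lab (x # xs))"
  let ?b = "\<lambda>xs. block_count (chain_labels lab (x # xs))"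
  let ?L = "\<lambda>xs. last (x # xs)"
  have "foldl (\<lambda>w k. frag_extend (mod_descent_pieri lab k) w) (frag_of x) (k # ks) =
      frag_extend ?G (mod_descent_pieri lab k x)"
    using foldl_frag_extend[where w = "mod_descent_pieri lab k x" and H = "mod_descent_pieri lab"]
    by simp
  also have "\<dots> = (\<Sum>xs\<in>upward_steps k x. frag_cmul (?c xs) (?G (?L xs)))"
    by (simp only: mod_descent_pieri_eq frag_extend_sum' frag_extend_cmul frag_extend_of)
  finally have "Poly_Mapping.lookup (foldl (\<lambda>w k. frag_extend (mod_descent_pieri lab k) w)
        (frag_of x) (k # ks)) y =
      (\<Sum>xs\<in>upward_steps k x. ?c xs * (\<Sum>zs\<in>chain_tails (?L xs) y. block_count (chain_labels lab (?L xs # zs)) ks))"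
    by (simp only: lookup_sum lookup_frag_cmul Cons.IH)
  also have "\<dots> = (\<Sum>(xs, zs)\<in>(SIGMA xs:upward_steps k x. chain_tails (?L xs) y).
      ?c xs * block_count (chain_labels lab (?L xs # zs)) ks)"
    by (subst sum.Sigma[symmetric]) (simp_all add: finite_upward_steps finite_chain_tails sum_distrib_left)
  also have "\<dots> = (\<Sum>xs | xs \<in> chain_tails x y \<and> k \<le> length xs. ?b xs (k # ks))"
  proof (rule sum.reindex_bij_witness[where
        i = "\<lambda>xs. (take k xs, drop k xs)" and j = "\<lambda>(xs, zs). xs @ zs"])
    fix p assume "p \<in> (SIGMA xs:upward_steps k x. chain_tails (?L xs) y)"
    then obtain xs zs where p: "p = (xs, zs)" and xs: "xs \<in> upward_steps k x"
      and zs: "zs \<in> chain_tails (?L xs) y" by auto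
    have len: "length xs = k" using xs by (simp add: upward_steps_def)
    show "(\<lambda>xs. (take k xs, drop k xs)) (case p of (xs, zs) \<Rightarrow> xs @ zs) = p"
      using len by (simp add: p)
    show "(case p of (xs, zs) \<Rightarrow> xs @ zs) \<in> {xs. xs \<in> chain_tails x y \<and> k \<le> length xs}"
      using xs zs len
      by (simp add: p chain_tails_def upward_steps_def successively_Cons_append del: successively.simps)
        (auto split: if_splits)
    show "?b (case p of (xs, zs) \<Rightarrow> xs @ zs) (k # ks) =
        (case p of (xs, zs) \<Rightarrow> ?c xs * block_count (chain_labels lab (?L xs # zs)) ks)"
      using len by (simp add: p chain_labels_append length_chain_labels)
  next
    fix xs assume "xs \<in> {xs. xs \<in> chain_tails x y \<and> k \<le> length xs}"
    then have xs: "successively (\<lessdot>) (x # xs)" "last (x # xs) = y" "k \<le> length xs"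
      by (auto simp: chain_tails_def)
    have "successively (\<lessdot>) (x # take k xs)" "successively (\<lessdot>) (last (x # take k xs) # drop k xs)"
      using xs(1) successively_Cons_append[of "(\<lessdot>)" x "take k xs" "drop k xs"] by simp_all
    moreover have "last (last (x # take k xs) # drop k xs) = last (x # take k xs @ drop k xs)"
      by (simp only: last_append last.simps append_is_Nil_conv split: if_splits) simp
    ultimately show "(take k xs, drop k xs) \<in> (SIGMA xs:upward_steps k x. chain_tails (?L xs) y)"
      using xs(2,3) by (simp add: chain_tails_def upward_steps_def del: last.simps successively.simps)
  qed auto
  \<comment> \<open>Chains with fewer than k steps contribute 0.\<close>
  also have "\<dots> = (\<Sum>xs\<in>chain_tails x y. ?b xs (k # ks))"
    by (intro sum.mono_neutral_left) (auto simp: finite_chain_tails length_chain_labels)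
  finally show ?case .
qed

end

section \<open>The function of a single interval\<close>

lemma frag_additive_eqI:
  fixes F G :: "('a \<Rightarrow>\<^sub>0 int) \<Rightarrow> int"
  assumes F: "\<And>u v. F (u + v) = F u + F v" and G: "\<And>u v. G (u + v) = G u + G v"
    and eq: "\<And>a. F (frag_of a) = G (frag_of a)"
  shows "F = G"
proof
  fix u
  have F0: "F 0 = 0" and G0: "G 0 = 0" using F[of 0 0] G[of 0 0] by simp_all
  have "F (- u) = - F u" "G (- u) = - G u" for u
    using F[of u "- u"] G[of u "- u"] F0 G0 by simp_all
  then show "F u = G u"
    by (induction u rule: frag_add_induct) (simp_all add: F G F0 G0 eq)
qed

lemma qsym_theta_add: "qsym_theta \<alpha> (\<Psi> + \<Phi>) = qsym_theta \<alpha> \<Psi> + qsym_theta \<alpha> \<Phi>"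
  by (simp add: qsym_theta_def sum_fun_apply qsym_M_def lookup_add distrib_left sum.distrib)

lemma chain_peak_comp_eq: "chain_peak_comp lab \<omega> = word_peak_comp (chain_labels lab \<omega>)"
  by (simp add: chain_peak_comp_def word_peak_comp_def Let_def)

text \<open>Both functionals are additive, and at a basis element both equal the sum of the block
  counts of the label words of the chains.\<close>

lemma (in labelled_poset) pieri_K_eq_peak_enumerator:
  "pieri_K (mod_descent_pieri lab) x y = peak_enumerator lab x y"
proof (rule frag_additive_eqI)
  fix \<alpha>
  have "peak_enumerator lab x y (frag_of \<alpha>) =
      (\<Sum>xs\<in>chain_tails x y. qsym_theta (word_peak_comp (chain_labels lab (x # xs))) (frag_of \<alpha>))"
    by (simp add: peak_enumerator_def sat_chains_eq sum.reindex sum_fun_apply chain_peak_comp_eq)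
  also have "\<dots> = (\<Sum>xs\<in>chain_tails x y. block_count (chain_labels lab (x # xs)) (parts \<alpha>))"
    by (intro sum.cong refl qsym_theta_word_peak_comp chain_labels_pos) (simp add: chain_tails_def)
  finally show "pieri_K (mod_descent_pieri lab) x y (frag_of \<alpha>) = peak_enumerator lab x y (frag_of \<alpha>)"
    by (simp add: pieri_K_def pieri_act_def lookup_foldl_pieri)
qed (simp_all add: pieri_K_def pieri_act_add_right lookup_add peak_enumerator_def sum_fun_apply
    qsym_theta_add sum.distrib)

section \<open>Products of intervals\<close>

text \<open>Finite sums of peak functions, each given by a word with positive letters; products of
  such functions can then be computed by shuffling the words.\<close>

inductive_set peak_positive :: "(nc \<Rightarrow> int) set" where
  zero: "0 \<in> peak_positive"
| add: "\<lbrakk>\<forall>b\<in>set u. 0 < b; F \<in> peak_positive\<rbrakk> \<Longrightarrow> qsym_theta (word_peak_comp u) + F \<in> peak_positive"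

lemma peak_positive_word: "\<forall>b\<in>set u. 0 < b \<Longrightarrow> qsym_theta (word_peak_comp u) \<in> peak_positive"
  using peak_positive.add[OF _ peak_positive.zero] by simp

lemma peak_positive_plus: "\<lbrakk>F \<in> peak_positive; G \<in> peak_positive\<rbrakk> \<Longrightarrow> F + G \<in> peak_positive"
  by (induction rule: peak_positive.induct) (simp_all add: peak_positive.add add.assoc)

lemma peak_positive_sum: "(\<And>i. i \<in> I \<Longrightarrow> F i \<in> peak_positive) \<Longrightarrow> (\<Sum>i\<in>I. F i) \<in> peak_positive"
  by (induction I rule: infinite_finite_induct) (auto simp: peak_positive.zero peak_positive_plus)

lemma qsym_rat_peak_positive:
  assumes "F \<in> peak_positive"
  shows "qsym_rat F \<in> Pi_rat"
proof -
  interpret vector_space rat_scale by (rule vector_space_rat_scale)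
  have qsym_rat_plus: "qsym_rat (F + G) = qsym_rat F + qsym_rat G" for F G
    by (auto simp: qsym_rat_def)
  have qsym_rat_zero: "qsym_rat 0 = 0" by (auto simp: qsym_rat_def)
  show ?thesis
    using assms unfolding Pi_rat_def
  proof (induction rule: peak_positive.induct)
    case (add u F)
    have "qsym_rat (qsym_theta (word_peak_comp u)) \<in> {qsym_rat (qsym_theta \<alpha>) | \<alpha>. peak_composition \<alpha>}"
      using peak_composition_word_peak_comp by blast
    from span_add[OF span_base[OF this] add.IH] show ?case by (simp only: qsym_rat_plus)
  qed (simp only: qsym_rat_zero span_zero)
qed

text \<open>The product of quasi-symmetric functions, dual to the coproduct.\<close>

definition conv :: "(nc \<Rightarrow> int) \<Rightarrow> (nc \<Rightarrow> int) \<Rightarrow> nc \<Rightarrow> int"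
  where "conv F G \<Psi> = frag_lin (\<lambda>(\<beta>, \<gamma>). F (frag_of \<beta>) * G (frag_of \<gamma>)) (nc_coproduct \<Psi>)"

lemma frag_lin_plus_fun: "frag_lin (\<lambda>a. f a + g a) u = frag_lin f u + frag_lin g u"
  by (induction u rule: frag_add_induct) (simp_all add: frag_lin_add frag_lin_minus)

lemma conv_simps:
  "conv 0 G = 0" "conv F 0 = 0"
  "conv (F + F') G = conv F G + conv F' G" "conv F (G + G') = conv F G + conv F G'"
  using frag_lin_cmult[of 0 "\<lambda>_. 0"]
  by (auto simp: conv_def fun_eq_iff case_prod_unfold distrib_left distrib_right frag_lin_plus_fun)

lemma nc_coproduct_add: "nc_coproduct (\<Psi> + \<Phi>) = nc_coproduct \<Psi> + nc_coproduct \<Phi>"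
  by (simp add: nc_coproduct_def frag_extend_add)

lemma word_peak_comp_shift: "word_peak_comp (map (\<lambda>b. m + b) u) = word_peak_comp u"
proof -
  have "peaks (map (\<lambda>b. m + b) u) = peaks u" by (auto simp: peaks_def)
  then show ?thesis by (simp add: word_peak_comp_def)
qed

text \<open>Peaks depend only on the relative order of the letters, so one word can be shifted away from the
  alphabet of the other.\<close>

lemma conv_word_thetas:
  assumes u: "\<forall>b\<in>set u. 0 < b" and v: "\<forall>b\<in>set v. 0 < b"
  shows "conv (qsym_theta (word_peak_comp u)) (qsym_theta (word_peak_comp v)) \<in> peak_positive"
proof -
  \<comment> \<open>Inserting 0 makes the maximum defined for empty \<open>u\<close> and
    nonnegative, so the shifted letters are positive and exceed those of \<open>u\<close>.\<close>
  define m where "m = Max (insert 0 (set u))"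
  define v' where "v' = map (\<lambda>b. m + b) v"
  have m: "0 \<le> m" "\<forall>b\<in>set u. b \<le> m" by (auto simp: m_def)
  have disj: "set u \<inter> set v' = {}" using m v by (fastforce simp: v'_def)
  have v': "\<forall>b\<in>set v'. 0 < b" using m v by (auto simp: v'_def)
  have pos: "\<forall>b\<in>set w. 0 < b" if "w \<in> shuffles u v'" for w
    using set_shuffles[OF that] u v' by auto
  have "conv (qsym_theta (word_peak_comp u)) (qsym_theta (word_peak_comp v')) =
      (\<Sum>w\<in>shuffles u v'. qsym_theta (word_peak_comp w))"
  proof (rule frag_additive_eqI)
    fix \<alpha>
    show "conv (qsym_theta (word_peak_comp u)) (qsym_theta (word_peak_comp v')) (frag_of \<alpha>) =
        (\<Sum>w\<in>shuffles u v'. qsym_theta (word_peak_comp w)) (frag_of \<alpha>)"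
      \<comment> \<open>At a basis element every peak function becomes a block count.\<close>
      using coproduct_block_count[OF disj, of "parts \<alpha>"]
      by (simp add: conv_def nc_coproduct_def qsym_theta_word_peak_comp u v' pos sum_fun_apply)
  qed (simp_all add: conv_def nc_coproduct_add frag_lin_add sum_fun_apply qsym_theta_add sum.distrib)
  moreover have "(\<Sum>w\<in>shuffles u v'. qsym_theta (word_peak_comp w)) \<in> peak_positive"
    by (intro peak_positive_sum peak_positive_word pos)
  ultimately show ?thesis by (simp add: v'_def word_peak_comp_shift)
qed

text \<open>Biadditivity of \<open>conv\<close> reduces this to two single words.\<close>

lemma peak_positive_conv:
  assumes "F \<in> peak_positive" "G \<in> peak_positive"
  shows "conv F G \<in> peak_positive"
  using assms
proof (induction rule: peak_positive.induct)
  case (add u F)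
  have "conv (qsym_theta (word_peak_comp u)) G \<in> peak_positive"
    using \<open>G \<in> peak_positive\<close>
  proof (induction rule: peak_positive.induct)
    case (add v G)
    then show ?case
      unfolding conv_simps by (intro peak_positive_plus conv_word_thetas \<open>\<forall>b\<in>set u. 0 < b\<close>)
  qed (simp only: conv_simps peak_positive.zero)
  then show ?case
    unfolding conv_simps using add by (intro peak_positive_plus) auto
qed (simp only: conv_simps peak_positive.zero)

lemma lookup_frag_bilin_Cons:
  "Poly_Mapping.lookup (frag_bilin (#) v w) (y # ys) =
    Poly_Mapping.lookup v y * Poly_Mapping.lookup w ys"
proof (induction v rule: frag_add_induct)
  case (of_basis a)
  show ?case
    by (induction w rule: frag_add_induct)
      (auto simp: frag_bilin_def frag_extend_add frag_extend_minus lookup_add lookup_single when_def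
        distrib_left)
qed (simp_all add: frag_bilin_def frag_extend_add frag_extend_minus lookup_add distrib_right)

text \<open>The iterated coproduct splits off its first tensor factor, which acts on
  \<open>x\<close> alone, and coefficients of pure tensors multiply. Hence the function of a product
  of intervals is the product of their functions.\<close>

lemma pieri_K_prod_Cons:
  "pieri_K_prod H (x # xs) (y # ys) = conv (pieri_K H x y) (pieri_K_prod H xs ys)"
proof
  fix \<Psi>
  \<comment> \<open>\<open>G xs \<beta>s\<close> is the image of the pure tensor \<open>xs\<close>
    when the components of \<open>\<beta>s\<close> act factor by factor.\<close>
  define G where "G = (\<lambda>xs \<beta>s. foldr (frag_bilin (#))
    (map2 (\<lambda>x \<beta>. pieri_act H (frag_of x) (frag_of \<beta>)) xs \<beta>s) (frag_of []))"
  have K: "pieri_K_prod H xs ys \<Psi> =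
      Poly_Mapping.lookup (frag_extend (G xs) (nc_iter_coproduct (length xs) \<Psi>)) ys" for xs ys \<Psi>
    by (simp add: pieri_K_prod_def pieri_tensor_act_def G_def)
  have bil: "frag_bilin f u (v + w) = frag_bilin f u v + frag_bilin f u w"
    "frag_bilin f u (- v) = - frag_bilin f u v" "frag_bilin f u 0 = 0"
    for f :: "'a \<Rightarrow> 'a list \<Rightarrow> 'a list" and u v w
    by (induction u rule: frag_add_induct) (simp_all add: frag_bilin_def frag_extend_add frag_extend_minus)
  have step: "frag_extend (G (x # xs)) (frag_bilin (#) (frag_of \<beta>) w) =
      frag_bilin (#) (pieri_act H (frag_of x) (frag_of \<beta>)) (frag_extend (G xs) w)" for \<beta> w
  proof (induction w rule: frag_add_induct)
    case (of_basis \<beta>s)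
    show ?case by (simp add: frag_bilin_def G_def)
  qed (simp_all add: bil frag_bilin_def[of _ "frag_of \<beta>"] frag_extend_add frag_extend_minus)
  have "Poly_Mapping.lookup (frag_extend (G (x # xs)) (frag_extend (\<lambda>(\<beta>, \<gamma>).
        frag_bilin (#) (frag_of \<beta>) (nc_iter_coproduct (length xs) (frag_of \<gamma>))) u)) (y # ys) =
      frag_lin (\<lambda>(\<beta>, \<gamma>). pieri_K H x y (frag_of \<beta>) * pieri_K_prod H xs ys (frag_of \<gamma>)) u" for u
    by (induction u rule: frag_add_induct)
      (auto simp: step lookup_frag_bilin_Cons K pieri_K_def frag_extend_add frag_extend_minus lookup_add
        frag_lin_add frag_lin_minus)
  then show "pieri_K_prod H (x # xs) (y # ys) \<Psi> = conv (pieri_K H x y) (pieri_K_prod H xs ys) \<Psi>"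
    by (simp add: K conv_def)
qed

text \<open>The empty product gives the counit, which is the peak function of the empty
  composition.\<close>

lemma pieri_K_prod_Nil: "pieri_K_prod H [] [] = qsym_theta (word_peak_comp [])"
proof (rule frag_additive_eqI)
  fix \<alpha>
  have "block_count [] (parts \<alpha>) = (if \<alpha> = 0 then 1 else 0)"
    using parts_pos[of \<alpha>] by (cases "parts \<alpha>") (auto simp: parts_zero parts_inject[symmetric])
  then show "pieri_K_prod H [] [] (frag_of \<alpha>) = qsym_theta (word_peak_comp []) (frag_of \<alpha>)"
    by (simp add: pieri_K_prod_def pieri_tensor_act_def qsym_theta_word_peak_comp lookup_single
        when_def)
qed (simp_all add: qsym_theta_add pieri_K_prod_def pieri_tensor_act_def frag_extend_cmul lookup_add
    distrib_right)

section \<open>The Eulerian property and the expansion by peak compositions\<close>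

context labelled_poset
begin

lemma finite_sat_chains: "finite (sat_chains x (y :: 'a))"
  by (simp add: sat_chains_eq finite_chain_tails)

lemma peak_positive_peak_enumerator: "peak_enumerator lab x y \<in> peak_positive"
  unfolding peak_enumerator_def sat_chains_eq
  by (intro peak_positive_sum)
    (auto simp: chain_peak_comp_eq chain_tails_def intro!: peak_positive_word chain_labels_pos[THEN bspec])

lemma peak_positive_pieri_K_prod:
  "list_all2 (\<le>) xs ys \<Longrightarrow> pieri_K_prod (mod_descent_pieri lab) xs ys \<in> peak_positive"
  by (induction rule: list_all2_induct)
    (simp_all add: pieri_K_prod_Nil pieri_K_prod_Cons peak_positive_word peak_positive_conv
      pieri_K_eq_peak_enumerator peak_positive_peak_enumerator)

lemma eulerian_mod_descent_pieri: "eulerian (mod_descent_pieri lab)"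
  by (simp add: eulerian_def qsym_rat_peak_positive pieri_K_eq_peak_enumerator
      peak_positive_peak_enumerator peak_positive_pieri_K_prod)

text \<open>Chains are grouped by their peak composition. The index set is the image of the finite
  set of chains, so the sum is genuinely finite.\<close>

lemma peak_enumerator_eq_sum_count:
  "peak_enumerator lab x y =
    (\<Sum>\<alpha> | peak_composition \<alpha> \<and> peak_chain_count lab x \<alpha> y \<noteq> 0.
      (\<lambda>\<Psi>. int (peak_chain_count lab x \<alpha> y) * qsym_theta \<alpha> \<Psi>))"
proof -
  \<comment> \<open>Since there are finitely many chains, a nonzero count means that some chain has
    this peak composition.\<close>
  have "{\<alpha>. peak_composition \<alpha> \<and> peak_chain_count lab x \<alpha> y \<noteq> 0} =
      chain_peak_comp lab ` sat_chains x y"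
    by (auto simp: peak_chain_count_def finite_sat_chains chain_peak_comp_eq
        peak_composition_word_peak_comp)
  moreover have "peak_enumerator lab x y = (\<Sum>\<alpha>\<in>chain_peak_comp lab ` sat_chains x y.
      \<Sum>\<omega> | \<omega> \<in> sat_chains x y \<and> chain_peak_comp lab \<omega> = \<alpha>. qsym_theta (chain_peak_comp lab \<omega>))"
    unfolding peak_enumerator_def by (rule sum.image_gen) (rule finite_sat_chains)
  moreover have "(\<Sum>\<omega> | \<omega> \<in> sat_chains x y \<and> chain_peak_comp lab \<omega> = \<alpha>. qsym_theta (chain_peak_comp lab \<omega>)) =
      (\<lambda>\<Psi>. int (peak_chain_count lab x \<alpha> y) * qsym_theta \<alpha> \<Psi>)" for \<alpha>
    by (auto simp: fun_eq_iff sum_fun_apply peak_chain_count_def)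
  ultimately show ?thesis by simp
qed

end

theorem theorem7p2:
  fixes lab :: "'a::order \<Rightarrow> 'a \<Rightarrow> int"
  assumes "labelled_poset lab"
  shows "eulerian (mod_descent_pieri lab) \<and>
    (\<forall>x y. x \<le> y \<longrightarrow>
      pieri_K (mod_descent_pieri lab) x y = peak_enumerator lab x y \<and>
      peak_enumerator lab x y =
        (\<Sum>\<alpha> | peak_composition \<alpha> \<and> peak_chain_count lab x \<alpha> y \<noteq> 0.
          (\<lambda>\<Psi>. int (peak_chain_count lab x \<alpha> y) * qsym_theta \<alpha> \<Psi>)))"
proof -
  interpret labelled_poset lab by fact
  show ?thesis
    using eulerian_mod_descent_pieri pieri_K_eq_peak_enumerator peak_enumerator_eq_sum_count by blast
qed

end
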